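(* Let $M_1, M_2$ be two $\star$-word-hyperbolic monoids. Then the monoid free product $M_1\ast M_2$ is $\star$-word-hyperbolic.
   Context: For a word $w = a_1\cdots a_n$ write $w^{\mathrm{rev}} = a_n\cdots a_1$. Let $M$ be a monoid generated by a finite set $A$, with associated surjective homomorphism $\pi_M\colon A^\ast\to M$; $u=_M v$ means $\pi_M(u)=\pi_M(v)$. A regular combing of $M$ is a regular language $R\subseteq A^\ast$ with $\pi_M(R)=M$. Let $\#_1,\#_2$ be new symbols not in $A$, and let $\mathcal{T}_M(R)=\{u\#_1 v\#_2 w^{\mathrm{rev}}\mid u,v,w\in R,\ u\cdot v=_M w\}$. The monoid $M$ is word-hyperbolic with respect to $R$ if $\mathcal{T}_M(R)$ is a context-free language. $M$ is $\star$-word-hyperbolic if it is word-hyperbolic with respect to some regular combing $R$ (over some finite generating set) satisfying $R^\ast=R$. The monoid free product of $M_1=\mathrm{Mon}\langle A_1\mid\mathscr{R}_1\rangle$ and $M_2=\mathrm{Mon}\langle A_2\mid\mathscr{R}_2\rangle$ with $A_1\cap A_2=\varnothing$ is $\mathrm{Mon}\langle A_1\cup A_2\mid\mathscr{R}_1\cup\mathscr{R}_2\rangle$, i.e. the coproduct in the category of monoids. *)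

theory Defs
  imports "HOL-Algebra.Group"
begin

section \<open>Regular and context-free languages\<close>

text \<open>
  Regularity is acceptance by a complete deterministic finite automaton over the finite
  alphabet \<open>A\<close>. State sets and sets of nonterminals are finite, so taking them to consist of
  natural numbers loses no generality.
\<close>

definition regular_language :: "'x set \<Rightarrow> 'x list set \<Rightarrow> bool" where
  "regular_language A L \<longleftrightarrow> finite A \<and>
     (\<exists>(Q :: nat set) \<delta> q0 F. finite Q \<and> q0 \<in> Q \<and> F \<subseteq> Q \<and> (\<forall>q\<in>Q. \<forall>a\<in>A. \<delta> q a \<in> Q) \<and>
        L = {w \<in> lists A. foldl \<delta> q0 w \<in> F})"

datatype ('n, 't) gsym = Nonterm 'n | Term 't

inductive derives_step ::
  "('n \<times> ('n, 't) gsym list) set \<Rightarrow> ('n, 't) gsym list \<Rightarrow> ('n, 't) gsym list \<Rightarrow> bool"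
  for P where
  "(X, \<alpha>) \<in> P \<Longrightarrow> derives_step P (l @ [Nonterm X] @ r) (l @ \<alpha> @ r)"

definition grammar_language :: "('n \<times> ('n, 't) gsym list) set \<Rightarrow> 'n \<Rightarrow> 't list set" where
  "grammar_language P S = {w. (derives_step P)\<^sup>*\<^sup>* [Nonterm S] (map Term w)}"

definition context_free_language :: "'t list set \<Rightarrow> bool" where
  "context_free_language L \<longleftrightarrow>
     (\<exists>(P :: (nat \<times> (nat, 't) gsym list) set) S. finite P \<and> L = grammar_language P S)"

definition kleene_star :: "'x list set \<Rightarrow> 'x list set" where
  "kleene_star L = concat ` lists L"


section \<open>Word-hyperbolic monoids\<close>

definition free_monoid :: "'x set \<Rightarrow> 'x list monoid" where
  "free_monoid A = \<lparr>carrier = lists A, mult = (@), one = []\<rparr>"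

text \<open>
  \<open>A\<close> is an alphabet of formal letters; distinct letters may denote the same element of \<open>M\<close>.
  Membership in \<^const>\<open>hom\<close> does not mention the unit, hence the separate clause.
\<close>

definition generates_via ::
  "('m, 'c) monoid_scheme \<Rightarrow> 'x set \<Rightarrow> ('x list \<Rightarrow> 'm) \<Rightarrow> bool" where
  "generates_via M A \<pi> \<longleftrightarrow> finite A \<and> \<pi> \<in> hom (free_monoid A) M \<and>
     \<pi> [] = \<one>\<^bsub>M\<^esub> \<and> \<pi> ` lists A = carrier M"

definition regular_combing ::
  "('m, 'c) monoid_scheme \<Rightarrow> 'x set \<Rightarrow> ('x list \<Rightarrow> 'm) \<Rightarrow> 'x list set \<Rightarrow> bool" where
  "regular_combing M A \<pi> R \<longleftrightarrow> regular_language A R \<and> \<pi> ` R = carrier M"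

datatype 'x marked = Letter 'x | Hash1 | Hash2

definition mult_table ::
  "('m, 'c) monoid_scheme \<Rightarrow> ('x list \<Rightarrow> 'm) \<Rightarrow> 'x list set \<Rightarrow> 'x marked list set" where
  "mult_table M \<pi> R =
     {map Letter u @ [Hash1] @ map Letter v @ [Hash2] @ map Letter (rev w) | u v w.
        u \<in> R \<and> v \<in> R \<and> w \<in> R \<and> \<pi> u \<otimes>\<^bsub>M\<^esub> \<pi> v = \<pi> w}"

definition word_hyperbolic_wrt ::
  "('m, 'c) monoid_scheme \<Rightarrow> ('x list \<Rightarrow> 'm) \<Rightarrow> 'x list set \<Rightarrow> bool" where
  "word_hyperbolic_wrt M \<pi> R \<longleftrightarrow> context_free_language (mult_table M \<pi> R)"

text \<open>
  The alphabet is existentially quantified and finite, so letters may be taken to be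
  natural numbers.
\<close>

definition star_word_hyperbolic :: "('m, 'c) monoid_scheme \<Rightarrow> bool" where
  "star_word_hyperbolic M \<longleftrightarrow>
     (\<exists>(A :: nat set) \<pi> R. generates_via M A \<pi> \<and> regular_combing M A \<pi> R \<and>
        word_hyperbolic_wrt M \<pi> R \<and> kleene_star R = R)"


section \<open>Monoid presentations\<close>

inductive pres_cong :: "'x set \<Rightarrow> ('x list \<times> 'x list) set \<Rightarrow> 'x list \<Rightarrow> 'x list \<Rightarrow> bool"
  for A \<R> where
  rel: "(u, v) \<in> \<R> \<Longrightarrow> pres_cong A \<R> u v"
| refl: "u \<in> lists A \<Longrightarrow> pres_cong A \<R> u u"
| sym: "pres_cong A \<R> u v \<Longrightarrow> pres_cong A \<R> v u"
| trans: "pres_cong A \<R> u v \<Longrightarrow> pres_cong A \<R> v w \<Longrightarrow> pres_cong A \<R> u w"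
| mult: "pres_cong A \<R> u v \<Longrightarrow> pres_cong A \<R> u' v' \<Longrightarrow> pres_cong A \<R> (u @ u') (v @ v')"

definition pres_class :: "'x set \<Rightarrow> ('x list \<times> 'x list) set \<Rightarrow> 'x list \<Rightarrow> 'x list set" where
  "pres_class A \<R> u = {v. pres_cong A \<R> u v}"

definition presented_monoid :: "'x set \<Rightarrow> ('x list \<times> 'x list) set \<Rightarrow> 'x list set monoid" where
  "presented_monoid A \<R> =
     \<lparr>carrier = pres_class A \<R> ` lists A,
      mult = (\<lambda>X Y. \<Union>x\<in>X. \<Union>y\<in>Y. pres_class A \<R> (x @ y)),
      one = pres_class A \<R> []\<rparr>"

definition is_presentation ::
  "('m, 'c) monoid_scheme \<Rightarrow> 'x set \<Rightarrow> ('x list \<times> 'x list) set \<Rightarrow> bool" where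
  "is_presentation M A \<R> \<longleftrightarrow> \<R> \<subseteq> lists A \<times> lists A \<and> M \<cong> presented_monoid A \<R>"

lemma pres_class_eq_iff:
  assumes "v \<in> lists A"
  shows "pres_class A \<R> u = pres_class A \<R> v \<longleftrightarrow> pres_cong A \<R> u v"
proof
  assume "pres_class A \<R> u = pres_class A \<R> v"
  with pres_cong.refl[OF assms] show "pres_cong A \<R> u v"
    unfolding pres_class_def by (metis mem_Collect_eq)
next
  assume "pres_cong A \<R> u v"
  then have "pres_cong A \<R> u w = pres_cong A \<R> v w" for w
    using pres_cong.trans[of A \<R> u v w] pres_cong.trans[OF pres_cong.sym, of A \<R> u v w]
    by iprover
  then show "pres_class A \<R> u = pres_class A \<R> v"
    by (simp only: pres_class_def)
qed

lemma presented_monoid_mult: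
  assumes "u \<in> lists A" "v \<in> lists A"
  shows "pres_class A \<R> u \<otimes>\<^bsub>presented_monoid A \<R>\<^esub> pres_class A \<R> v = pres_class A \<R> (u @ v)"
proof -
  have uv: "u @ v \<in> lists A"
    using assms by simp
  have eq: "pres_class A \<R> (x @ y) = pres_class A \<R> (u @ v)"
    if "x \<in> pres_class A \<R> u" "y \<in> pres_class A \<R> v" for x y
  proof -
    have "pres_cong A \<R> u x" "pres_cong A \<R> v y"
      using that by (simp_all add: pres_class_def)
    then have "pres_cong A \<R> (x @ y) (u @ v)"
      by (rule pres_cong.sym[OF pres_cong.mult])
    then show ?thesis
      by (simp only: pres_class_eq_iff[OF uv])
  qed
  have mem: "u \<in> pres_class A \<R> u" "v \<in> pres_class A \<R> v"
    using assms unfolding pres_class_def by (simp_all add: pres_cong.refl)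
  have "(\<Union>x\<in>pres_class A \<R> u. \<Union>y\<in>pres_class A \<R> v. pres_class A \<R> (x @ y))
      = (\<Union>x\<in>pres_class A \<R> u. \<Union>y\<in>pres_class A \<R> v. pres_class A \<R> (u @ v))"
    by (intro SUP_cong) (simp_all only: eq)
  also have "\<dots> = pres_class A \<R> (u @ v)"
    using mem by blast
  finally show ?thesis
    by (simp add: presented_monoid_def)
qed

lemma monoid_presented_monoid: "monoid (presented_monoid A \<R>)"
proof -
  let ?M = "presented_monoid A \<R>"
  have car: "carrier ?M = pres_class A \<R> ` lists A" and one: "\<one>\<^bsub>?M\<^esub> = pres_class A \<R> []"
    by (simp_all add: presented_monoid_def)
  have app: "u @ v \<in> lists A" if "u \<in> lists A" "v \<in> lists A" for u v
    using that by simp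
  have nil: "[] \<in> lists A"
    by simp
  show ?thesis
    by (intro monoidI; unfold car one; (elim imageE)?; hypsubst?)
       (simp_all only: presented_monoid_mult app nil append_assoc append_Nil append_Nil2 imageI)
qed

end

theory Submission
  imports Defs "HOL-Library.Countable"
begin

text \<open>
  Relabel the letters so that the combings \<open>R\<^sub>1\<close>, \<open>R\<^sub>2\<close> of the factors live over disjoint alphabets,
  and take \<open>R = (R\<^sub>1 \<union> R\<^sub>2)\<^sup>*\<close>. Deleting blocks that are trivial in their factor and merging
  neighbouring blocks of the same factor (this stays inside \<open>R\<^sub>i\<close> because \<open>R\<^sub>i\<^sup>* = R\<^sub>i\<close>) turns a word
  of \<open>R\<close> into an alternating sequence of nontrivial blocks, whose values are unique by the normal
  form theorem for free products. In a true equation \<open>u v = w\<close> between such sequences, the end of \<open>u\<close>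
  cancels block by block against the beginning of \<open>v\<close>, at most one block of \<open>w\<close> is a product of a block
  of \<open>u\<close> and a block of \<open>v\<close>, and all remaining blocks agree pairwise. This is a nested
  pattern, hence generated by a grammar whose sets of right-hand sides are transductions of the
  multiplication tables of the factors, with trivial words inserted after every letter. Such a
  grammar, having finitely many context-free sets of right-hand sides, generates a context-free
  language. It derives only true equations, among them all those between words of \<open>R\<close>; the table of
  \<open>R\<close> is cut out by one more transduction.
\<close>


section \<open>Derivations and nested grammars\<close>

text \<open>The obstacle is that trivial pieces of a word in the combing are nested: once a block is
  deleted, its neighbours may merge and vanish in turn. A slot for a trivial word after every letter
  absorbs this hierarchy, and filling a slot never changes the value of a word. The price is that a
  filled slot may split a block into pieces outside the combing. Soundness is therefore proved for
  all words over the joint alphabet, and membership in the combing is imposed only at the very end.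
  Writing \<open>w\<close> backwards is what turns the blockwise agreement of two sequences into
  nesting; it also calls for a separate, reversed copy of the trivial words. The condition that each
  combing is its own Kleene star enters a second time in the regularity proof: membership in the
  joint combing can be tested on maximal blocks by a deterministic automaton. Completeness runs
  derivations backwards: the terminal word stays fixed while the sentential form is contracted to
  the start symbol. The big-step relation \<open>gen\<close> suits this, and it also permits
  infinite sets of productions.\<close>

inductive gen :: "('n \<times> ('n, 't) gsym list) set \<Rightarrow> ('n, 't) gsym list \<Rightarrow> 't list \<Rightarrow> bool"
  for P where
  gen_Nil: "gen P [] []"
| gen_Term: "gen P s w \<Longrightarrow> gen P (Term t # s) (t # w)"
| gen_Nonterm: "(X, \<alpha>) \<in> P \<Longrightarrow> gen P \<alpha> u \<Longrightarrow> gen P s w \<Longrightarrow> gen P (Nonterm X # s) (u @ w)"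

inductive_cases gen_NilE: "gen P [] w"
inductive_cases gen_TermE: "gen P (Term t # s) w"
inductive_cases gen_NontermE: "gen P (Nonterm X # s) w"

lemma gen_append: "gen P s u \<Longrightarrow> gen P s' u' \<Longrightarrow> gen P (s @ s') (u @ u')"
  by (induction rule: gen.induct) (auto intro: gen.intros)

lemma gen_appendE:
  assumes "gen P (s @ s') w"
  obtains u u' where "w = u @ u'" "gen P s u" "gen P s' u'"
proof -
  have "\<exists>u u'. w = u @ u' \<and> gen P s u \<and> gen P s' u'"
    using assms
  proof (induction s arbitrary: w)
    case Nil
    then show ?case by (auto intro: gen_Nil)
  next
    case (Cons x s)
    show ?case
    proof (cases x)
      case (Nonterm X)
      with Cons.prems obtain \<alpha> a b where "(X, \<alpha>) \<in> P" "gen P \<alpha> a" "gen P (s @ s') b" "w = a @ b"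
        by (auto elim: gen_NontermE)
      with Cons.IH[of b] Nonterm show ?thesis
        by (metis append.assoc gen_Nonterm)
    next
      case (Term t)
      with Cons.prems obtain b where "gen P (s @ s') b" "w = t # b"
        by (auto elim: gen_TermE)
      with Cons.IH[of b] Term show ?thesis
        by (metis append_Cons gen_Term)
    qed
  qed
  then show ?thesis using that by blast
qed

lemma gen_single: "(X, \<alpha>) \<in> P \<Longrightarrow> gen P \<alpha> w \<Longrightarrow> gen P [Nonterm X] w"
  using gen_Nonterm[OF _ _ gen_Nil] by fastforce

text \<open>A production read backwards: a right-hand side inside the sentential form is contracted
  to its nonterminal while the derived word stays the same. Completeness of the grammar below is a
  chain of such contractions.\<close>

lemma gen_fold: "(X, \<alpha>) \<in> P \<Longrightarrow> gen P (l @ \<alpha> @ r) w \<Longrightarrow> gen P (l @ Nonterm X # r) w"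
  by (elim gen_appendE) (auto intro!: gen_append intro: gen_Nonterm)

lemma gen_map_Term: "gen P (map Term w) w"
  by (induction w) (auto intro: gen.intros)

lemma gen_map_Term_iff: "gen P (map Term w) v \<longleftrightarrow> v = w"
proof
  show "gen P (map Term w) v \<Longrightarrow> v = w"
    by (induction w arbitrary: v) (auto elim: gen_NilE gen_TermE)
qed (simp add: gen_map_Term)

lemma derives_context:
  assumes "(derives_step P)\<^sup>*\<^sup>* s s'"
  shows "(derives_step P)\<^sup>*\<^sup>* (l @ s @ r) (l @ s' @ r)"
  using assms
proof (induction rule: rtranclp_induct)
  case (step y z)
  from step.hyps(2) have "derives_step P (l @ y @ r) (l @ z @ r)"
  proof cases
    case (1 X \<alpha> l' r')
    then show ?thesis
      using derives_step.intros[of X \<alpha> P "l @ l'" "r' @ r"] by simp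
  qed
  with step.IH show ?case by (rule rtranclp.rtrancl_into_rtrancl)
qed simp

lemma gen_imp_derives: "gen P s w \<Longrightarrow> (derives_step P)\<^sup>*\<^sup>* s (map Term w)"
proof (induction rule: gen.induct)
  case (gen_Term s w t)
  then show ?case using derives_context[of P s "map Term w" "[Term t]" "[]"] by simp
next
  case (gen_Nonterm X \<alpha> u s w)
  have "derives_step P (Nonterm X # s) (\<alpha> @ s)"
    using derives_step.intros[OF gen_Nonterm(1), of "[]" s] by simp
  also have "(derives_step P)\<^sup>*\<^sup>* (\<alpha> @ s) (map Term u @ s)"
    using derives_context[OF gen_Nonterm.IH(1), of "[]" s] by simp
  also have "(derives_step P)\<^sup>*\<^sup>* (map Term u @ s) (map Term u @ map Term w)"
    using derives_context[OF gen_Nonterm.IH(2), of "map Term u" "[]"] by simp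
  finally show ?case by simp
qed simp

lemma derives_imp_gen:
  assumes "(derives_step P)\<^sup>*\<^sup>* s (map Term w)"
  shows "gen P s w"
  using assms
proof (induction rule: converse_rtranclp_induct)
  case base
  show ?case by (rule gen_map_Term)
next
  case (step y z)
  from step.hyps(1) step.IH show ?case
    by cases (auto intro: gen_fold)
qed

lemma grammar_language_gen: "grammar_language P S = {w. gen P [Nonterm S] w}"
  unfolding grammar_language_def using gen_imp_derives derives_imp_gen by blast

lemma gen_map_nonterm:
  "gen P s w \<Longrightarrow> gen ((\<lambda>(X, \<alpha>). (f X, map (map_gsym f (\<lambda>t. t)) \<alpha>)) ` P) (map (map_gsym f (\<lambda>t. t)) s) w"
  by (induction rule: gen.induct) (force intro: gen.intros)+

section \<open>Interpreting nonterminals by languages\<close>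

primrec word_lang :: "('n \<Rightarrow> 't list set) \<Rightarrow> ('n, 't) gsym list \<Rightarrow> 't list set" where
  "word_lang V [] = {[]}"
| "word_lang V (s # \<alpha>) =
     {u @ w | u w. u \<in> (case s of Nonterm X \<Rightarrow> V X | Term t \<Rightarrow> {[t]}) \<and> w \<in> word_lang V \<alpha>}"

lemma word_lang_append: "word_lang V (\<alpha> @ \<beta>) = {u @ w | u w. u \<in> word_lang V \<alpha> \<and> w \<in> word_lang V \<beta>}"
proof (induction \<alpha>)
  case (Cons s \<alpha>)
  have "x \<in> word_lang V ((s # \<alpha>) @ \<beta>) \<longleftrightarrow>
      (\<exists>u v w. x = u @ v @ w \<and> u \<in> (case s of Nonterm X \<Rightarrow> V X | Term t \<Rightarrow> {[t]}) \<and>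
        v \<in> word_lang V \<alpha> \<and> w \<in> word_lang V \<beta>)" for x
    using Cons.IH by fastforce
  then show ?case by (fastforce simp flip: append_assoc)
qed simp

lemma word_lang_map_Term: "word_lang V (map Term w) = {w}"
  by (induction w) auto

text \<open>The generated languages are the least solution of the system of productions, so every
  assignment \<open>V\<close> closed under the productions bounds them from above. All soundness
  claims below are instances with a suitable \<open>V\<close>.\<close>

lemma gen_imp_word_lang:
  assumes "\<And>X \<alpha>. (X, \<alpha>) \<in> P \<Longrightarrow> word_lang V \<alpha> \<subseteq> V X"
  shows "gen P s w \<Longrightarrow> w \<in> word_lang V s"
  by (induction rule: gen.induct) (use assms in \<open>fastforce+\<close>)

text \<open>Give \<open>f X\<close> the language of \<open>X\<close> in the original grammar and
  give every nonterminal outside the range the empty language. Injectivity of \<open>f\<close> makes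
  this assignment closed under the relabelled productions.\<close>

lemma gen_unmap_nonterm:
  assumes "inj f"
    and "gen ((\<lambda>(X, \<alpha>). (f X, map (map_gsym f (\<lambda>t. t)) \<alpha>)) ` P) (map (map_gsym f (\<lambda>t. t)) s) w"
  shows "gen P s w"
proof -
  define V where "V = (\<lambda>Y. {w. \<exists>X. Y = f X \<and> gen P [Nonterm X] w})"
  have V: "w \<in> word_lang V (map (map_gsym f (\<lambda>t. t)) \<alpha>) \<Longrightarrow> gen P \<alpha> w" for \<alpha> w
  proof (induction \<alpha> arbitrary: w)
    case (Cons x \<alpha>)
    then show ?case
      using injD[OF assms(1)]
      by (cases x) (auto simp: V_def intro: gen_Term gen_append[of P "[_]", simplified])
  qed (simp add: gen_Nil)
  have "w \<in> word_lang V (map (map_gsym f (\<lambda>t. t)) s)"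
    using assms(2) by (rule gen_imp_word_lang[rotated]) (auto simp: V_def intro: gen_single V[unfolded V_def])
  then show ?thesis by (rule V)
qed

text \<open>The definition of context-freeness fixes natural numbers as nonterminals; coding them
  lets later constructions use sums, pairs and triples.\<close>

lemma context_free_gen:
  fixes P :: "('n :: countable \<times> ('n, 't) gsym list) set"
  assumes "finite P"
  shows "context_free_language {w. gen P [Nonterm S] w}"
proof -
  let ?f = "to_nat :: 'n \<Rightarrow> nat"
  let ?P = "(\<lambda>(X, \<alpha>). (?f X, map (map_gsym ?f (\<lambda>t. t)) \<alpha>)) ` P"
  have "gen P [Nonterm S] w \<longleftrightarrow> gen ?P [Nonterm (?f S)] w" for w
    using gen_map_nonterm[of P "[Nonterm S]" w ?f] gen_unmap_nonterm[of ?f P "[Nonterm S]" w]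
    by auto
  then have "{w. gen P [Nonterm S] w} = grammar_language ?P (?f S)"
    by (simp add: grammar_language_gen)
  moreover have "finite ?P" using assms by simp
  ultimately show ?thesis unfolding context_free_language_def by blast
qed

lemma context_free_genE:
  assumes "context_free_language L"
  obtains P :: "(nat \<times> (nat, 't) gsym list) set" and S
  where "finite P" "L = {w :: 't list. gen P [Nonterm S] w}"
  using assms unfolding context_free_language_def grammar_language_gen by blast

lemma context_free_singleton: "context_free_language {x}"
proof -
  have "{w. gen {(0 :: nat, map Term x)} [Nonterm 0] w} = {x}"
    by (auto simp: gen_map_Term_iff elim!: gen_NontermE gen_NilE intro!: gen_single gen_map_Term)
  then show ?thesis
    using context_free_gen[of "{(0 :: nat, map Term x)}" 0] by simp
qed

text \<open>A terminal of an inner grammar is itself a symbol of the outer grammar, so it is opened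
  up; the tag \<open>Inl\<close> marks outer nonterminals and \<open>Inr (k, Y)\<close> those of the
  \<open>k\<close>-th inner grammar.\<close>

primrec embed_sym :: "nat \<Rightarrow> (nat, ('n, 't) gsym) gsym \<Rightarrow> ('n + nat \<times> nat, 't) gsym" where
  "embed_sym k (Nonterm Y) = Nonterm (Inr (k, Y))"
| "embed_sym k (Term s) = map_gsym Inl (\<lambda>t. t) s"

text \<open>Closure under substitution, with recursion allowed: each possibly infinite set of
  right-hand sides is spelled out by its own finite grammar, and all of them are joined into one.
  Indexing by list position lets a nonterminal own several sets.\<close>

lemma context_free_nested:
  fixes Ls :: "('n :: countable \<times> ('n, 't) gsym list set) list"
  assumes cf: "\<And>X L. (X, L) \<in> set Ls \<Longrightarrow> context_free_language L"
  shows "context_free_language {w. gen {(X, \<alpha>). \<exists>L. (X, L) \<in> set Ls \<and> \<alpha> \<in> L} [Nonterm S] w}"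
    (is "context_free_language {w. gen ?E _ w}")
proof -
  have "\<exists>G. finite (fst G) \<and> snd (Ls ! k) = {w. gen (fst G) [Nonterm (snd G :: nat)] w}"
    if k: "k < length Ls" for k
  proof -
    have "context_free_language (snd (Ls ! k))"
      using cf[of "fst (Ls ! k)"] nth_mem[OF k] by simp
    then obtain P :: "(nat \<times> (nat, ('n, 't) gsym) gsym list) set" and S
      where "finite P" "snd (Ls ! k) = {w. gen P [Nonterm S] w}"
      by (rule context_free_genE)
    then show ?thesis by (intro exI[of _ "(P, S)"]) simp
  qed
  then have "\<forall>k. \<exists>G. k < length Ls \<longrightarrow> finite (fst G) \<and>
      snd (Ls ! k) = {w. gen (fst G) [Nonterm (snd G :: nat)] w}"
    by blast
  from choice[OF this] obtain G where G: "\<And>k. k < length Ls \<Longrightarrow> finite (fst (G k)) \<and>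
      snd (Ls ! k) = {w. gen (fst (G k)) [Nonterm (snd (G k) :: nat)] w}"
    by blast
  define P where "P = (\<Union>k<length Ls.
     insert (Inl (fst (Ls ! k)), [Nonterm (Inr (k, snd (G k)))])
       ((\<lambda>(Y, \<alpha>). (Inr (k, Y), map (embed_sym k) \<alpha>)) ` fst (G k)))"
  have P_Inl: "(Inl (fst (Ls ! k)), [Nonterm (Inr (k, snd (G k)))]) \<in> P" if "k < length Ls" for k
    unfolding P_def by (intro UN_I[of k] insertI1) (simp add: that)
  have P_Inr: "(Inr (k, Y), map (embed_sym k) \<alpha>) \<in> P"
    if "k < length Ls" "(Y, \<alpha>) \<in> fst (G k)" for k Y \<alpha>
    unfolding P_def by (intro UN_I[of k] insertI2 image_eqI[of _ _ "(Y, \<alpha>)"]) (simp_all add: that)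
  have 1: "gen P (map (map_gsym Inl (\<lambda>t. t)) s) w \<Longrightarrow> k < length Ls \<Longrightarrow> gen (fst (G k)) \<alpha> s \<Longrightarrow>
      gen P (map (embed_sym k) \<alpha>) w" for k \<alpha> s w
  proof (rotate_tac 2, induction arbitrary: w rule: gen.induct)
    case (gen_Term \<alpha> s t)
    then show ?case
      by (cases t) (auto elim!: gen_TermE gen_NontermE intro: gen.intros)
  next
    case (gen_Nonterm Y \<beta> u \<alpha> s)
    from gen_Nonterm.prems obtain a b where "w = a @ b" "gen P (map (map_gsym Inl (\<lambda>t. t)) u) a"
        "gen P (map (map_gsym Inl (\<lambda>t. t)) s) b"
      by (auto elim: gen_appendE)
    moreover have "(Inr (k, Y), map (embed_sym k) \<beta>) \<in> P"
      using gen_Nonterm.hyps(1) gen_Nonterm.prems(2) by (rule P_Inr[rotated])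
    ultimately show ?case using gen_Nonterm.IH gen_Nonterm.prems(2)
      by (auto intro: gen.gen_Nonterm)
  qed (simp add: gen_Nil)
  have 2: "gen ?E s w \<Longrightarrow> gen P (map (map_gsym Inl (\<lambda>t. t)) s) w" for s w
  proof (induction rule: gen.induct)
    case (gen_Nonterm X \<alpha> u s w)
    then obtain k where k: "k < length Ls" "fst (Ls ! k) = X" "\<alpha> \<in> snd (Ls ! k)"
      by (auto simp: in_set_conv_nth)
    then have "gen P [Nonterm (Inr (k, snd (G k)))] u"
      using 1[OF gen_Nonterm.IH(1) k(1), of "[Nonterm (snd (G k))]"] G[OF k(1)] by simp
    moreover have "(Inl X, [Nonterm (Inr (k, snd (G k)))]) \<in> P"
      using P_Inl[OF k(1)] k(2) by simp
    ultimately show ?case using gen_Nonterm.IH(2) by (auto intro: gen.gen_Nonterm)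
  qed (auto intro: gen.intros)
  \<comment> \<open>An inner nonterminal stands for the words obtained by completing a fragment of a
    right-hand side and then expanding that fragment in the outer grammar.\<close>
  define V where "V = (\<lambda>Z. case Z of Inl X \<Rightarrow> {w. gen ?E [Nonterm X] w}
    | Inr (k, Y) \<Rightarrow> {w. \<exists>s. gen (fst (G k)) [Nonterm Y] s \<and> gen ?E s w})"
  have V: "w \<in> word_lang V (map (embed_sym k) \<alpha>) \<Longrightarrow> \<exists>s. gen (fst (G k)) \<alpha> s \<and> gen ?E s w"
    for k \<alpha> w
  proof (induction \<alpha> arbitrary: w)
    case Nil
    then show ?case by (auto intro: gen_Nil)
  next
    case (Cons x \<alpha>)
    then obtain u v where uv: "w = u @ v" "u \<in> word_lang V [embed_sym k x]"
        "v \<in> word_lang V (map (embed_sym k) \<alpha>)"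
      by auto
    from Cons.IH[OF uv(3)] obtain s where s: "gen (fst (G k)) \<alpha> s" "gen ?E s v" by blast
    have "\<exists>s'. gen (fst (G k)) [x] s' \<and> gen ?E s' u"
    proof (cases x)
      case (Nonterm Y)
      with uv(2) show ?thesis by (auto simp: V_def)
    next
      case (Term z)
      have "gen (fst (G k)) [x] [z]" unfolding Term by (intro gen.intros)
      moreover have "gen ?E [z] u"
        using uv(2) Term by (cases z) (auto simp: V_def intro: gen.intros)
      ultimately show ?thesis by blast
    qed
    then obtain s' where "gen (fst (G k)) [x] s'" "gen ?E s' u" by blast
    with s have "gen (fst (G k)) (x # \<alpha>) (s' @ s)" "gen ?E (s' @ s) w"
      using gen_append[of _ "[x]"] uv(1) by (auto intro: gen_append)
    then show ?case by blast
  qed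
  have 3: "w \<in> word_lang V s" if "gen P s w" for s w
    using _ that
  proof (rule gen_imp_word_lang)
    fix Z \<beta> assume "(Z, \<beta>) \<in> P"
    then obtain k where k: "k < length Ls"
      and "Z = Inl (fst (Ls ! k)) \<and> \<beta> = [Nonterm (Inr (k, snd (G k)))] \<or>
        (\<exists>Y \<alpha>. Z = Inr (k, Y) \<and> \<beta> = map (embed_sym k) \<alpha> \<and> (Y, \<alpha>) \<in> fst (G k))"
      unfolding P_def by auto
    then consider (L) "Z = Inl (fst (Ls ! k))" "\<beta> = [Nonterm (Inr (k, snd (G k)))]"
      | (R) Y \<alpha> where "Z = Inr (k, Y)" "\<beta> = map (embed_sym k) \<alpha>" "(Y, \<alpha>) \<in> fst (G k)"
      by blast
    then show "word_lang V \<beta> \<subseteq> V Z"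
    proof cases
      case L
      have "gen ?E [Nonterm (fst (Ls ! k))] w" if "s \<in> snd (Ls ! k)" "gen ?E s w" for s w
        using nth_mem[OF k] that
        by (intro gen_single[of _ s]) (auto intro!: exI[of _ "snd (Ls ! k)"])
      then show ?thesis using L G[OF k] by (auto simp: V_def)
    next
      case R
      then show ?thesis by (auto simp: V_def dest!: V[unfolded V_def] intro: gen_single)
    qed
  qed
  have "gen P [Nonterm (Inl S)] w \<longleftrightarrow> gen ?E [Nonterm S] w" for w
    using 2[of "[Nonterm S]" w] 3[of "[Nonterm (Inl S)]" w] by (auto simp: V_def)
  moreover have "finite P" unfolding P_def using G by auto
  ultimately show ?thesis using context_free_gen[of P "Inl S"] by simp
qed


section \<open>Finite transductions\<close>

text \<open>Runs of a nondeterministic transducer that reads exactly one letter per transition and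
  emits any word, so that a terminal of a grammar corresponds to a single transition.\<close>

inductive path :: "('q \<times> 't \<times> 'o list \<times> 'q) set \<Rightarrow> 'q \<Rightarrow> 't list \<Rightarrow> 'o list \<Rightarrow> 'q \<Rightarrow> bool"
  for \<Delta> where
  path_Nil: "path \<Delta> p [] [] p"
| path_Cons: "(p, t, x, q) \<in> \<Delta> \<Longrightarrow> path \<Delta> q w y r \<Longrightarrow> path \<Delta> p (t # w) (x @ y) r"

inductive_cases path_NilE: "path \<Delta> p [] y r"
inductive_cases path_ConsE: "path \<Delta> p (t # w) y r"

lemma path_Nil_iff: "path \<Delta> p [] y r \<longleftrightarrow> y = [] \<and> r = p"
  by (auto elim: path_NilE intro: path_Nil)

lemma path_Cons_iff:
  "path \<Delta> p (t # w) y r \<longleftrightarrow> (\<exists>x q z. (p, t, x, q) \<in> \<Delta> \<and> path \<Delta> q w z r \<and> y = x @ z)"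
  by (blast elim: path_ConsE intro: path_Cons)

lemma path_append_iff:
  "path \<Delta> p (v @ w) y r \<longleftrightarrow> (\<exists>x q z. path \<Delta> p v x q \<and> path \<Delta> q w z r \<and> y = x @ z)"
proof (induction v arbitrary: p y)
  case Nil
  show ?case by (auto simp: path_Nil_iff)
next
  case (Cons t v)
  show ?case unfolding append_Cons path_Cons_iff Cons.IH by (metis append.assoc)
qed

context
  fixes \<Delta> :: "('q \<times> 't \<times> 'o list \<times> 'q) set" and Q :: "'q set"
begin

text \<open>The triple construction of Bar-Hillel: \<open>(p, X, q)\<close> generates the outputs of
  runs from \<open>p\<close> to \<open>q\<close> on words generated by \<open>X\<close>.
  Intermediate states are guessed inside \<open>Q\<close>, which keeps the number of productions
  finite.\<close>

primrec lift_step :: "('n, 't) gsym \<Rightarrow> 'q \<Rightarrow> (('q \<times> 'n \<times> 'q, 'o) gsym list \<times> 'q) set" where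
  "lift_step (Term t) p = (\<lambda>(_, _, x, q). (map Term x, q)) ` {d \<in> \<Delta>. fst d = p \<and> fst (snd d) = t}"
| "lift_step (Nonterm X) p = (\<lambda>q. ([Nonterm (p, X, q)], q)) ` Q"

primrec lift_path :: "('n, 't) gsym list \<Rightarrow> 'q \<Rightarrow> (('q \<times> 'n \<times> 'q, 'o) gsym list \<times> 'q) set" where
  "lift_path [] p = {([], p)}"
| "lift_path (s # \<alpha>) p = (\<Union>(x, q)\<in>lift_step s p. (\<lambda>(\<beta>, r). (x @ \<beta>, r)) ` lift_path \<alpha> q)"

definition lift_prods ::
  "('n \<times> ('n, 't) gsym list) set \<Rightarrow> (('q \<times> 'n \<times> 'q) \<times> ('q \<times> 'n \<times> 'q, 'o) gsym list) set" where
  "lift_prods P = (\<Union>(X, \<alpha>)\<in>P. \<Union>p\<in>Q. (\<lambda>(\<beta>, q). ((p, X, q), \<beta>)) ` lift_path \<alpha> p)"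

lemma finite_lift_path: "finite \<Delta> \<Longrightarrow> finite Q \<Longrightarrow> finite (lift_path \<alpha> p)"
proof (induction \<alpha> arbitrary: p)
  case (Cons s \<alpha>)
  have "finite (lift_step s p)" using Cons.prems by (cases s) auto
  then show ?case using Cons by auto
qed simp

lemma finite_lift_prods: "finite \<Delta> \<Longrightarrow> finite Q \<Longrightarrow> finite P \<Longrightarrow> finite (lift_prods P)"
  unfolding lift_prods_def by (auto intro!: finite_lift_path)

lemma gen_lift:
  assumes states: "\<forall>(p, t, x, q)\<in>\<Delta>. p \<in> Q \<and> q \<in> Q"
  shows "gen P \<alpha> w \<Longrightarrow> path \<Delta> p w y q \<Longrightarrow> p \<in> Q \<Longrightarrow>
    q \<in> Q \<and> (\<exists>\<beta>. (\<beta>, q) \<in> lift_path \<alpha> p \<and> gen (lift_prods P) \<beta> y)"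
proof (induction arbitrary: p y q rule: gen.induct)
  case gen_Nil
  then show ?case by (auto simp: path_Nil_iff intro: gen.gen_Nil)
next
  case (gen_Term s w t)
  from gen_Term.prems(1) obtain x q' z
    where d: "(p, t, x, q') \<in> \<Delta>" "path \<Delta> q' w z q" "y = x @ z"
    unfolding path_Cons_iff by blast
  from gen_Term.IH[OF d(2)] states d(1) obtain \<beta>
    where "q \<in> Q" "(\<beta>, q) \<in> lift_path s q'" "gen (lift_prods P) \<beta> z" by blast
  moreover have "(map Term x, q') \<in> lift_step (Term t) p" using d(1) by force
  ultimately show ?case using d(3) by (force intro: gen_append gen_map_Term)
next
  case (gen_Nonterm X \<alpha> u s w)
  from gen_Nonterm.prems(1) obtain x q' z
    where d: "path \<Delta> p u x q'" "path \<Delta> q' w z q" "y = x @ z"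
    unfolding path_append_iff by blast
  from gen_Nonterm.IH(1)[OF d(1)] gen_Nonterm.prems(2) obtain \<beta>1
    where 1: "q' \<in> Q" "(\<beta>1, q') \<in> lift_path \<alpha> p" "gen (lift_prods P) \<beta>1 x" by blast
  from gen_Nonterm.IH(2)[OF d(2) 1(1)] obtain \<beta>2
    where 2: "q \<in> Q" "(\<beta>2, q) \<in> lift_path s q'" "gen (lift_prods P) \<beta>2 z" by blast
  have "((p, X, q'), \<beta>1) \<in> lift_prods P"
    unfolding lift_prods_def using gen_Nonterm.hyps(1) gen_Nonterm.prems(2) 1(2) by force
  then have "gen (lift_prods P) (Nonterm (p, X, q') # \<beta>2) y"
    using 1(3) 2(3) d(3) by (auto intro: gen.intros)
  moreover have "(Nonterm (p, X, q') # \<beta>2, q) \<in> lift_path (Nonterm X # s) p"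
    using 1(1) 2(2) by force
  ultimately show ?case using 2(1) by blast
qed

lemma gen_unlift:
  assumes "gen (lift_prods P) [Nonterm (p, X, q)] y"
  shows "\<exists>w. gen P [Nonterm X] w \<and> path \<Delta> p w y q"
proof -
  define V where "V = (\<lambda>(p, X, q). {y. \<exists>w. gen P [Nonterm X] w \<and> path \<Delta> p w y q})"
  have V: "(\<beta>, q) \<in> lift_path \<alpha> p \<Longrightarrow> y \<in> word_lang V \<beta> \<Longrightarrow> \<exists>w. gen P \<alpha> w \<and> path \<Delta> p w y q"
    for \<alpha> \<beta> p q y
  proof (induction \<alpha> arbitrary: \<beta> p y)
    case Nil
    then show ?case by (auto intro: gen_Nil path_Nil)
  next
    case (Cons s \<alpha>)
    then obtain x p' \<gamma> where *: "(x, p') \<in> lift_step s p" "(\<gamma>, q) \<in> lift_path \<alpha> p'" "\<beta> = x @ \<gamma>"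
      by auto
    with Cons.prems(2) obtain u v where uv: "u \<in> word_lang V x" "v \<in> word_lang V \<gamma>" "y = u @ v"
      by (auto simp: word_lang_append)
    from Cons.IH[OF *(2) uv(2)] obtain w where w: "gen P \<alpha> w" "path \<Delta> p' w v q" by blast
    have "\<exists>w'. gen P [s] w' \<and> path \<Delta> p w' u p'"
    proof (cases s)
      case (Term t)
      with *(1) uv(1) have "(p, t, u, p') \<in> \<Delta>" by (auto simp: word_lang_map_Term)
      then have "path \<Delta> p [t] u p'" by (simp add: path_Cons_iff path_Nil_iff)
      then show ?thesis using Term gen_map_Term[of P "[t]"] by auto
    next
      case (Nonterm X)
      with *(1) uv(1) show ?thesis by (auto simp: V_def)
    qed
    then obtain w' where "gen P [s] w'" "path \<Delta> p w' u p'" by blast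
    with w have "gen P (s # \<alpha>) (w' @ w)" "path \<Delta> p (w' @ w) y q"
      using gen_append[of P "[s]"] uv(3) by (auto simp: path_append_iff)
    then show ?case by blast
  qed
  have "y \<in> word_lang V [Nonterm (p, X, q)]"
    using assms
    by (rule gen_imp_word_lang[rotated])
       (fastforce simp: lift_prods_def V_def dest: V[unfolded V_def] intro: gen_single)
  then show ?thesis by (simp add: V_def)
qed

end

lemma context_free_transduce:
  fixes \<Delta> :: "('q :: countable \<times> 't \<times> 'o list \<times> 'q) set"
  assumes "context_free_language L" "finite \<Delta>"
  shows "context_free_language {y. \<exists>w\<in>L. path \<Delta> p w y q}"
proof -
  from assms(1) obtain P :: "(nat \<times> (nat, 't) gsym list) set" and S
    where P: "finite P" "L = {w. gen P [Nonterm S] w}"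
    by (rule context_free_genE)
  \<comment> \<open>The end points are added because a run on the empty word may stay in a state
    that no transition mentions.\<close>
  define Q where "Q = insert p (insert q ((\<lambda>(p, t, x, q). p) ` \<Delta> \<union> (\<lambda>(p, t, x, q). q) ` \<Delta>))"
  have Q: "p \<in> Q" "q \<in> Q" "finite Q" "\<forall>(p, t, x, q)\<in>\<Delta>. p \<in> Q \<and> q \<in> Q"
    using assms(2) by (force simp: Q_def)+
  have "gen (lift_prods \<Delta> Q P) [Nonterm (p, S, q)] y \<longleftrightarrow> (\<exists>w\<in>L. path \<Delta> p w y q)" for y
  proof
    assume "\<exists>w\<in>L. path \<Delta> p w y q"
    then obtain w where "gen P [Nonterm S] w" "path \<Delta> p w y q" using P(2) by blast
    then obtain \<beta>
      where "(\<beta>, q) \<in> lift_path \<Delta> Q [Nonterm S] p" "gen (lift_prods \<Delta> Q P) \<beta> y"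
      using gen_lift[OF Q(4)] Q(1) by blast
    then show "gen (lift_prods \<Delta> Q P) [Nonterm (p, S, q)] y" by auto
  qed (use gen_unlift P(2) in fast)
  then show ?thesis
    using context_free_gen[OF finite_lift_prods[OF assms(2) Q(3) P(1)], of "(p, S, q)"] by simp
qed

section \<open>Transductions of tables\<close>

definition table :: "('a list \<times> 'a list \<times> 'a list) set \<Rightarrow> 'a marked list set" where
  "table T = {map Letter u @ [Hash1] @ map Letter v @ [Hash2] @ map Letter (rev w) | u v w. (u, v, w) \<in> T}"

lemma mult_table_eq:
  "mult_table M \<pi> R = table {(u, v, w). u \<in> R \<and> v \<in> R \<and> w \<in> R \<and> \<pi> u \<otimes>\<^bsub>M\<^esub> \<pi> v = \<pi> w}"
  unfolding mult_table_def table_def by simp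

text \<open>The state counts the separators passed, so each component has its own substitution, and
  letters outside \<open>U\<close>, \<open>V\<close>, \<open>W\<close> find no transition. The words
  substituted for the letters of \<open>rev w\<close> are not reversed themselves.\<close>

lemma context_free_table_subst:
  assumes "context_free_language (table T)" "finite U" "finite V" "finite W"
  shows "context_free_language {concat (map f u) @ x @ concat (map g v) @ y @ concat (map h (rev w)) |
    u v w. (u, v, w) \<in> T \<and> u \<in> lists U \<and> v \<in> lists V \<and> w \<in> lists W}"
proof -
  define \<Delta> where "\<Delta> = (\<lambda>c. (0 :: nat, Letter c, f c, 0 :: nat)) ` U \<union> {(0, Hash1, x, 1)} \<union>
    (\<lambda>c. (1, Letter c, g c, 1)) ` V \<union> {(1, Hash2, y, 2)} \<union> (\<lambda>c. (2, Letter c, h c, 2)) ` W"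
  have L: "(0, Letter c, z, q) \<in> \<Delta> \<longleftrightarrow> c \<in> U \<and> z = f c \<and> q = 0"
    "(1, Letter c, z, q) \<in> \<Delta> \<longleftrightarrow> c \<in> V \<and> z = g c \<and> q = 1"
    "(2, Letter c, z, q) \<in> \<Delta> \<longleftrightarrow> c \<in> W \<and> z = h c \<and> q = 2"
    "(0, Hash1, z, q) \<in> \<Delta> \<longleftrightarrow> z = x \<and> q = 1"
    "(1, Hash2, z, q) \<in> \<Delta> \<longleftrightarrow> z = y \<and> q = 2" for c z q
    by (auto simp: \<Delta>_def)
  have 0: "path \<Delta> 0 (map Letter u) z q \<longleftrightarrow> u \<in> lists U \<and> z = concat (map f u) \<and> q = 0" for u z q
    by (induction u arbitrary: z) (auto simp: path_Nil_iff path_Cons_iff L)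
  have 1: "path \<Delta> 1 (map Letter v) z q \<longleftrightarrow> v \<in> lists V \<and> z = concat (map g v) \<and> q = 1" for v z q
    by (induction v arbitrary: z) (auto simp: path_Nil_iff path_Cons_iff L simp del: One_nat_def)
  have 2: "path \<Delta> 2 (map Letter v) z q \<longleftrightarrow> v \<in> lists W \<and> z = concat (map h v) \<and> q = 2" for v z q
    by (induction v arbitrary: z) (auto simp: path_Nil_iff path_Cons_iff L)
  have rev: "rev w \<in> lists W \<longleftrightarrow> w \<in> lists W" for w by auto
  have path: "path \<Delta> 0 (map Letter u @ [Hash1] @ map Letter v @ [Hash2] @ map Letter (rev w)) z 2 \<longleftrightarrow>
      u \<in> lists U \<and> v \<in> lists V \<and> w \<in> lists W \<and>
      z = concat (map f u) @ x @ concat (map g v) @ y @ concat (map h (rev w))" for u v w z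
    by (auto simp: path_append_iff path_Cons_iff path_Nil_iff 0 1 2 L rev
        simp del: One_nat_def)
  have "{z. \<exists>t\<in>table T. path \<Delta> 0 t z 2} = {z. \<exists>u v w. (u, v, w) \<in> T \<and>
      path \<Delta> 0 (map Letter u @ [Hash1] @ map Letter v @ [Hash2] @ map Letter (rev w)) z 2}"
    unfolding table_def by blast
  also have "\<dots> = {concat (map f u) @ x @ concat (map g v) @ y @ concat (map h (rev w)) |
      u v w. (u, v, w) \<in> T \<and> u \<in> lists U \<and> v \<in> lists V \<and> w \<in> lists W}"
    unfolding path by blast
  finally have "{z. \<exists>t\<in>table T. path \<Delta> 0 t z 2} = \<dots>" .
  moreover have "finite \<Delta>" unfolding \<Delta>_def using assms by simp
  ultimately show ?thesis using context_free_transduce[OF assms(1), of \<Delta> 0 2] by simp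
qed

lemma foldl_closed:
  "(\<And>q a. q \<in> Q \<Longrightarrow> a \<in> A \<Longrightarrow> \<delta> q a \<in> Q) \<Longrightarrow> q \<in> Q \<Longrightarrow> w \<in> lists A \<Longrightarrow> foldl \<delta> q w \<in> Q"
  by (induction w arbitrary: q) auto

text \<open>One automaton for \<open>K\<close> serves all three components; a state pairs the number
  of separators passed with a state of the automaton. A separator can be read only in an accepting
  state, and the first one restarts the automaton.\<close>

lemma context_free_table_restrict:
  assumes "context_free_language (table T)" "regular_language A K"
  shows "context_free_language (table (T \<inter> K \<times> K \<times> K))"
proof -
  from assms(2) obtain Q \<delta> q0 F where fin: "finite A" "finite Q" and q0: "q0 \<in> Q" and F: "F \<subseteq> Q"
    and \<delta>: "\<And>q a. q \<in> Q \<Longrightarrow> a \<in> A \<Longrightarrow> \<delta> q a \<in> Q"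
    and K: "K = {w \<in> lists A. foldl \<delta> (q0 :: nat) w \<in> F}"
    unfolding regular_language_def by blast
  define \<Delta> where "\<Delta> =
      (\<lambda>(q, c). ((0 :: nat, q), Letter c, [Letter c], (0 :: nat, \<delta> q c))) ` (Q \<times> A) \<union>
      (\<lambda>q. ((0, q), Hash1, [Hash1], (1, q0))) ` F \<union>
      (\<lambda>(q, c). ((1, q), Letter c, [Letter c], (1, \<delta> q c))) ` (Q \<times> A) \<union>
      (\<lambda>(q, q'). ((1, q), Hash2, [Hash2], (2, q'))) ` (F \<times> F) \<union>
      (\<lambda>(q, c). ((2, \<delta> q c), Letter c, [Letter c], (2, q))) ` (Q \<times> A)"
  have L: "q \<in> Q \<Longrightarrow> ((0, q), Letter c, z, r) \<in> \<Delta> \<longleftrightarrow> c \<in> A \<and> z = [Letter c] \<and> r = (0, \<delta> q c)"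
    "q \<in> Q \<Longrightarrow> ((1, q), Letter c, z, r) \<in> \<Delta> \<longleftrightarrow> c \<in> A \<and> z = [Letter c] \<and> r = (1, \<delta> q c)"
    "((2, q), Letter c, z, r) \<in> \<Delta> \<longleftrightarrow> (\<exists>p\<in>Q. c \<in> A \<and> q = \<delta> p c \<and> z = [Letter c] \<and> r = (2, p))"
    "((0, q), Hash1, z, r) \<in> \<Delta> \<longleftrightarrow> q \<in> F \<and> z = [Hash1] \<and> r = (1, q0)"
    "((1, q), Hash2, z, r) \<in> \<Delta> \<longleftrightarrow> q \<in> F \<and> z = [Hash2] \<and> (\<exists>q'\<in>F. r = (2, q'))" for q c z r
    by (auto simp: \<Delta>_def)
  have 0: "q \<in> Q \<Longrightarrow> path \<Delta> (0, q) (map Letter u) z r \<longleftrightarrow>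
      u \<in> lists A \<and> z = map Letter u \<and> r = (0, foldl \<delta> q u)" for u z q r
    by (induction u arbitrary: z q) (auto simp: path_Nil_iff path_Cons_iff L \<delta>)
  have 1: "q \<in> Q \<Longrightarrow> path \<Delta> (1, q) (map Letter u) z r \<longleftrightarrow>
      u \<in> lists A \<and> z = map Letter u \<and> r = (1, foldl \<delta> q u)" for u z q r
    by (induction u arbitrary: z q) (auto simp: path_Nil_iff path_Cons_iff L \<delta> simp del: One_nat_def)
  \<comment> \<open>The reversed word is read by guessing an accepting state and running the automaton backwards.\<close>
  have 2: "path \<Delta> (2, q) (map Letter (rev w)) z (2, q0) \<longleftrightarrow>
      w \<in> lists A \<and> z = map Letter (rev w) \<and> q = foldl \<delta> q0 w" for w z q
  proof (induction w arbitrary: z q rule: rev_induct)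
    case Nil
    show ?case by (auto simp: path_Nil_iff)
  next
    case (snoc c w)
    have "w \<in> lists A \<Longrightarrow> foldl \<delta> q0 w \<in> Q" by (rule foldl_closed[OF \<delta> q0])
    then show ?case
      by (auto simp: path_Cons_iff L snoc.IH)
  qed
  have path: "path \<Delta> (0, q0) (map Letter u @ [Hash1] @ map Letter v @ [Hash2] @ map Letter (rev w)) z (2, q0)
      \<longleftrightarrow> u \<in> K \<and> v \<in> K \<and> w \<in> K \<and>
      z = map Letter u @ [Hash1] @ map Letter v @ [Hash2] @ map Letter (rev w)" for u v w z
    by (auto simp: path_append_iff path_Cons_iff path_Nil_iff 0[OF q0] 1[OF q0] 2 L K
        simp del: One_nat_def)
  have "{z. \<exists>t\<in>table T. path \<Delta> (0, q0) t z (2, q0)} = {z. \<exists>u v w. (u, v, w) \<in> T \<and>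
      path \<Delta> (0, q0) (map Letter u @ [Hash1] @ map Letter v @ [Hash2] @ map Letter (rev w)) z (2, q0)}"
    unfolding table_def by blast
  also have "\<dots> = table (T \<inter> K \<times> K \<times> K)"
    unfolding path table_def by blast
  finally have "{z. \<exists>t\<in>table T. path \<Delta> (0, q0) t z (2, q0)} = \<dots>" .
  moreover have "finite F" using F fin finite_subset by blast
  then have "finite \<Delta>" unfolding \<Delta>_def using fin by simp
  ultimately show ?thesis using context_free_transduce[OF assms(1), of \<Delta> "(0, q0)" "(2, q0)"] by simp
qed


section \<open>Regularity of the combined combing\<close>

lemma kleene_star_append: "u \<in> kleene_star L \<Longrightarrow> v \<in> kleene_star L \<Longrightarrow> u @ v \<in> kleene_star L"
  unfolding kleene_star_def
  by (elim imageE) (simp del: concat_append add: concat_append[symmetric])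

lemma kleene_star_Nil: "[] \<in> kleene_star L"
  unfolding kleene_star_def by (rule image_eqI[of _ _ "[]"]) auto

lemma kleene_star_incl: "u \<in> L \<Longrightarrow> u \<in> kleene_star L"
  unfolding kleene_star_def by (rule image_eqI[of _ _ "[u]"]) auto

lemma concat_in_closed:
  assumes "[] \<in> K" "\<And>u v. u \<in> K \<Longrightarrow> v \<in> K \<Longrightarrow> u @ v \<in> K"
  shows "us \<in> lists K \<Longrightarrow> concat us \<in> K"
  by (induction us) (auto intro: assms)

lemma kleene_star_idem: "kleene_star (kleene_star L) = kleene_star L"
proof
  show "kleene_star (kleene_star L) \<subseteq> kleene_star L"
    unfolding kleene_star_def[of "kleene_star L"]
    by (rule image_subsetI) (rule concat_in_closed[OF kleene_star_Nil kleene_star_append])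
  show "kleene_star L \<subseteq> kleene_star (kleene_star L)"
    by (rule subsetI) (rule kleene_star_incl)
qed

lemma regular_languageI:
  fixes \<delta> :: "'q :: countable \<Rightarrow> 'a \<Rightarrow> 'q"
  assumes "finite A" "finite Q" "q0 \<in> Q" "F \<subseteq> Q" "\<And>q a. q \<in> Q \<Longrightarrow> a \<in> A \<Longrightarrow> \<delta> q a \<in> Q"
    and "L = {w \<in> lists A. foldl \<delta> q0 w \<in> F}"
  shows "regular_language A L"
proof -
  let ?\<delta> = "\<lambda>n a. to_nat (\<delta> (from_nat n) a)"
  have run: "foldl ?\<delta> (to_nat q) w = to_nat (foldl \<delta> q w)" for q w
    by (induction w arbitrary: q) auto
  have "L = {w \<in> lists A. foldl ?\<delta> (to_nat q0) w \<in> to_nat ` F}"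
    unfolding run assms(6) by auto
  then show ?thesis
    unfolding regular_language_def using assms(1-5)
    by (intro conjI exI[of _ "to_nat ` Q"] exI[of _ ?\<delta>] exI[of _ "to_nat q0"] exI[of _ "to_nat ` F"])
       auto
qed

lemma regular_language_lists: "regular_language A R \<Longrightarrow> R \<subseteq> lists A"
  unfolding regular_language_def by auto

text \<open>Since each \<open>R i\<close> contains the empty word and is closed under concatenation,
  a word lies in the star exactly if each of its maximal one-sided blocks lies in the corresponding
  \<open>R i\<close>. The automata can thus be switched deterministically, at the letters where the
  side changes.\<close>

lemma regular_language_star_Un:
  fixes B :: "bool \<Rightarrow> 'a set"
  assumes disj: "B False \<inter> B True = {}"
    and reg: "\<And>i. regular_language (B i) (R i)" and star: "\<And>i. kleene_star (R i) = R i"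
  shows "regular_language (B False \<union> B True) (kleene_star (R False \<union> R True))"
proof -
  from reg have "\<forall>i. \<exists>D. finite (fst D) \<and> fst (snd (snd D)) \<in> fst D \<and> snd (snd (snd D)) \<subseteq> fst D \<and>
      (\<forall>q\<in>fst D. \<forall>a\<in>B i. fst (snd D) q a \<in> fst D) \<and>
      R i = {w \<in> lists (B i). foldl (fst (snd D)) (fst (snd (snd D)) :: nat) w \<in> snd (snd (snd D))}"
    unfolding regular_language_def by simp
  from choice[OF this] obtain D where D: "\<And>i. finite (fst (D i)) \<and>
      fst (snd (snd (D i))) \<in> fst (D i) \<and> snd (snd (snd (D i))) \<subseteq> fst (D i) \<and>
      (\<forall>q\<in>fst (D i). \<forall>a\<in>B i. fst (snd (D i)) q a \<in> fst (D i)) \<and>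
      R i = {w \<in> lists (B i).
        foldl (fst (snd (D i))) (fst (snd (snd (D i))) :: nat) w \<in> snd (snd (snd (D i)))}"
    by blast
  define Q \<delta> q0 F where "Q i = fst (D i)" and "\<delta> i = fst (snd (D i))"
    and "q0 i = fst (snd (snd (D i)))" and "F i = snd (snd (snd (D i)))" for i
  have fin: "finite (Q i)" and q0: "q0 i \<in> Q i" and F: "F i \<subseteq> Q i"
    and \<delta>: "q \<in> Q i \<Longrightarrow> a \<in> B i \<Longrightarrow> \<delta> i q a \<in> Q i"
    and R: "R i = {w \<in> lists (B i). foldl (\<delta> i) (q0 i) w \<in> F i}" for i q a
    unfolding Q_def \<delta>_def q0_def F_def using D[of i] by blast+
  have R_Nil: "[] \<in> R i" for i
    using kleene_star_Nil[of "R i"] star by simp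
  have R_append: "u \<in> R i \<Longrightarrow> v \<in> R i \<Longrightarrow> u @ v \<in> R i" for u v i
    using kleene_star_append[of u "R i" v] star by simp
  have q0F: "q0 i \<in> F i" for i
    using R_Nil[of i] R by simp
  let ?K = "kleene_star (R False \<union> R True)"
  have R_K: "u \<in> ?K" if "u \<in> R i" for u i
    using that by (cases i) (auto intro: kleene_star_incl)
  define side where "side c \<longleftrightarrow> c \<in> B True" for c
  have side: "side c = i" if "c \<in> B i" for c i
    using that disj by (cases i) (auto simp: side_def)
  have side_B: "c \<in> B (side c)" if "c \<in> B False \<union> B True" for c
    using that by (cases "side c") (auto simp: side_def)
  \<comment> \<open>\<open>None\<close> is the dead state. On a change of side the finished block
    must be accepted, and the other automaton starts afresh with the current letter.\<close>
  define step where "step s c = (case s of None \<Rightarrow> None | Some (i, q) \<Rightarrow>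
      if i = side c then Some (i, \<delta> i q c)
      else if q \<in> F i then Some (side c, \<delta> (side c) (q0 (side c)) c) else None)" for s c
  define Q' where "Q' = insert None (Some ` (SIGMA i:UNIV. Q i))"
  define F' where "F' = Some ` (SIGMA i:UNIV. F i)"
  \<comment> \<open>Starting on side \<open>False\<close> is harmless: \<open>q0 False\<close> is
    accepting, so the run can change sides at the first letter.\<close>
  define run where "run w = foldl step (Some (False, q0 False)) w" for w
  have stay: "foldl step (Some (i, q)) w = Some (i, foldl (\<delta> i) q w)" if "w \<in> lists (B i)" for i q w
    using that by (induction w arbitrary: q) (auto simp: step_def side)
  \<comment> \<open>Here \<open>y\<close> collects the completed blocks and \<open>x\<close> is the
    part of the current block read so far.\<close>
  have run_word: "run w = Some (i, q) \<Longrightarrow> w \<in> lists (B False \<union> B True) \<Longrightarrow>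
      \<exists>y x. w = y @ x \<and> y \<in> ?K \<and> x \<in> lists (B i) \<and> q = foldl (\<delta> i) (q0 i) x" for w i q
  proof (induction w arbitrary: i q rule: rev_induct)
    case Nil
    then show ?case by (auto simp: run_def kleene_star_Nil)
  next
    case (snoc c w)
    then obtain j p where p: "run w = Some (j, p)" "step (Some (j, p)) c = Some (i, q)"
      by (cases "run w") (auto simp: run_def step_def)
    with snoc obtain y x where yx: "w = y @ x" "y \<in> ?K" "x \<in> lists (B j)" "p = foldl (\<delta> j) (q0 j) x"
      by auto
    have c: "c \<in> B (side c)" using side_B snoc.prems by simp
    show ?case
    proof (cases "j = side c")
      case True
      with p yx c show ?thesis by (intro exI[of _ y] exI[of _ "x @ [c]"]) (auto simp: step_def)
    next
      case False
      with p(2) have pF: "p \<in> F j" "i = side c" "q = \<delta> (side c) (q0 (side c)) c"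
        by (auto simp: step_def split: if_splits)
      with yx have "x \<in> R j" using R by auto
      with yx have "w \<in> ?K" by (auto intro: kleene_star_append R_K)
      with pF c show ?thesis by (intro exI[of _ w] exI[of _ "[c]"]) auto
    qed
  qed
  have K_lists: "?K \<subseteq> lists (B False \<union> B True)"
    using concat_in_closed[of "lists (B False \<union> B True)"] R
    unfolding kleene_star_def by (fastforce simp: lists_eq_set)
  \<comment> \<open>Here \<open>x\<close> is the current block, assembled from consecutive factors
    of the same side; closure under concatenation keeps it in \<open>R i\<close>.\<close>
  have run_K: "\<exists>i y x. run (concat rs) = Some (i, foldl (\<delta> i) (q0 i) x) \<and> x \<in> R i"
    if "rs \<in> lists (R False \<union> R True)" for rs
    using that
  proof (induction rs rule: rev_induct)
    case Nil
    show ?case by (rule exI[of _ False]) (auto simp: run_def R_Nil intro!: exI[of _ "[]"])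
  next
    case (snoc r rs)
    then obtain i x where x: "run (concat rs) = Some (i, foldl (\<delta> i) (q0 i) x)" "x \<in> R i" by auto
    from snoc.prems obtain j where r: "r \<in> R j" by auto
    have rB: "r \<in> lists (B j)" using r R by auto
    have eq: "run (concat (rs @ [r])) = foldl step (Some (i, foldl (\<delta> i) (q0 i) x)) r"
      using x by (simp add: run_def)
    show ?case
    proof (cases "i = j \<or> r = []")
      case True
      then show ?thesis
        using eq stay[OF rB] r x(2) R_append
        by (cases "r = []") (auto simp flip: foldl_append)
    next
      case False
      then obtain c r' where c: "r = c # r'" by (cases r) auto
      with rB side have "side c = j" by auto
      moreover have "foldl (\<delta> i) (q0 i) x \<in> F i" using x(2) R by auto
      ultimately have "step (Some (i, foldl (\<delta> i) (q0 i) x)) c = Some (j, \<delta> j (q0 j) c)"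
        using False by (auto simp: step_def)
      then have "run (concat (rs @ [r])) = Some (j, foldl (\<delta> j) (q0 j) r)"
        using eq c stay[of r' j] rB by simp
      with r show ?thesis by blast
    qed
  qed
  have "?K = {w \<in> lists (B False \<union> B True). foldl step (Some (False, q0 False)) w \<in> F'}"
  proof (intro equalityI subsetI CollectI conjI)
    fix w assume w: "w \<in> ?K"
    then show "w \<in> lists (B False \<union> B True)" using K_lists by blast
    from w show "foldl step (Some (False, q0 False)) w \<in> F'"
      using run_K R unfolding kleene_star_def F'_def run_def by fastforce
  next
    fix w assume "w \<in> {w \<in> lists (B False \<union> B True). foldl step (Some (False, q0 False)) w \<in> F'}"
    then obtain i q where "run w = Some (i, q)" "q \<in> F i" "w \<in> lists (B False \<union> B True)"
      by (auto simp: F'_def run_def)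
    with run_word[of w i q] obtain y x where "w = y @ x" "y \<in> ?K" "x \<in> R i"
      using R by blast
    then show "w \<in> ?K"
      by (auto intro: kleene_star_append R_K)
  qed
  moreover have "finite (B False \<union> B True)"
    using reg unfolding regular_language_def by blast
  ultimately show ?thesis
  proof (intro regular_languageI[of _ Q' "Some (False, q0 False)" F' step])
    show "finite Q'" unfolding Q'_def by (simp add: fin)
    show "Some (False, q0 False) \<in> Q'" unfolding Q'_def using q0 by auto
    show "F' \<subseteq> Q'" unfolding Q'_def F'_def using F by auto
    show "step s a \<in> Q'" if "s \<in> Q'" "a \<in> B False \<union> B True" for s a
    proof (cases s)
      case (Some iq)
      obtain i q where iq: "iq = (i, q)" by fastforce
      have q: "q \<in> Q i" using that(1) Some iq by (auto simp: Q'_def)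
      show ?thesis
      proof (cases "i = side a")
        case True
        then show ?thesis
          using \<delta>[OF q] side_B[OF that(2)] Some iq by (simp add: step_def Q'_def image_iff)
      next
        case False
        then show ?thesis
          using \<delta>[OF q0 side_B[OF that(2)]] Some iq by (simp add: step_def Q'_def image_iff)
      qed
    qed (simp add: step_def Q'_def)
  qed
qed


section \<open>A grammar for the multiplication table\<close>

text \<open>\<open>One\<close> and \<open>OneRev\<close> are separate because a reversed trivial
  word need not be trivial. \<open>Cancel\<close> yields words around the first separator,
  \<open>Match\<close> around the second, \<open>Prod\<close> around both.\<close>

datatype nonterm = One | OneRev | Cancel | Match | Prod | Start

instance nonterm :: countable
  by countable_datatype

text \<open>A slot follows each letter but none precedes the first. The front slot always comes from
  the left: from a preceding letter, from the rule producing a separator, or from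
  \<open>Start\<close>.\<close>

definition sprout :: "'n \<Rightarrow> 'a list \<Rightarrow> ('n, 'a marked) gsym list" where
  "sprout Z u = concat (map (\<lambda>c. [Term (Letter c), Nonterm Z]) u)"

lemma sprout_simps [simp]:
  "sprout Z [] = []"
  "sprout Z (c # u) = Term (Letter c) # Nonterm Z # sprout Z u"
  "sprout Z (u @ v) = sprout Z u @ sprout Z v"
  by (simp_all add: sprout_def)

definition flat :: "('i \<times> 'a list) list \<Rightarrow> 'a list" where
  "flat us = concat (map snd us)"

lemma flat_simps [simp]:
  "flat [] = []"
  "flat (b # us) = snd b @ flat us"
  "flat (us @ vs) = flat us @ flat vs"
  by (simp_all add: flat_def)

text \<open>Kept generic in \<open>K\<close> and \<open>triv\<close> because it is used for the
  combings, for the reversed combings, and for arbitrary words over the presentation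
  alphabets.\<close>

definition reduced :: "('i \<Rightarrow> 'a list set) \<Rightarrow> ('i \<Rightarrow> 'a list \<Rightarrow> bool) \<Rightarrow> ('i \<times> 'a list) list \<Rightarrow> bool" where
  "reduced K triv us \<longleftrightarrow> distinct_adj (map fst us) \<and> (\<forall>(i, p)\<in>set us. p \<in> K i \<and> \<not> triv i p)"

text \<open>When a letter is prepended, the former leading nonterminal becomes the slot behind that
  letter, and a new leading one deriving the empty word is put in front.\<close>

lemma gen_sprout_prefix:
  assumes "(Z, []) \<in> P" "gen P (Nonterm Z # s) w"
  shows "gen P (Nonterm Z # sprout Z u @ s) (map Letter u @ w)"
proof (induction u)
  case (Cons c u)
  then have "gen P (Term (Letter c) # Nonterm Z # sprout Z u @ s) (Letter c # map Letter u @ w)"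
    by (rule gen_Term)
  from gen_Nonterm[OF assms(1) gen_Nil this] show ?case by simp
qed (simp add: assms(2))

text \<open>Blocks are absorbed from right to left. A new block merges with the first reduced block
  if both belong to the same factor; should the result be trivial, it is contracted into the leading
  slot. What remains is a tail of a reduced sequence, so no further deletion is triggered.\<close>

lemma gen_reduced:
  assumes P: "(Z, []) \<in> P" "\<And>i x. x \<in> K i \<Longrightarrow> triv i x \<Longrightarrow> (Z, Nonterm Z # sprout Z x) \<in> P"
    and closed: "\<And>i x y. x \<in> K i \<Longrightarrow> y \<in> K i \<Longrightarrow> x @ y \<in> K i"
  shows "rs \<in> lists (\<Union>i. K i) \<Longrightarrow> \<exists>us. reduced K triv us \<and>
    gen P (Nonterm Z # sprout Z (flat us)) (map Letter (concat rs))"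
proof (induction rs)
  case Nil
  show ?case
    by (rule exI[of _ "[]"]) (use P(1) in \<open>auto simp: reduced_def intro: gen_single gen_Nil\<close>)
next
  case (Cons r rs)
  then obtain us i where us: "reduced K triv us" and r: "r \<in> K i"
    and g: "gen P (Nonterm Z # sprout Z (flat us)) (map Letter (concat rs))"
    by auto
  obtain x us' where x: "r @ flat us = x @ flat us'" "x \<in> K i"
    and us': "reduced K triv us'" "us' = [] \<or> fst (hd us') \<noteq> i"
  proof (cases "us \<noteq> [] \<and> fst (hd us) = i")
    case True
    then obtain p us' where "us = (i, p) # us'" by (cases us) auto
    with us r closed show ?thesis
      by (intro that[of "r @ p" us']) (auto simp: reduced_def distinct_adj_Cons hd_map)
  qed (use us r that[of r us] in auto)
  have g': "gen P (Nonterm Z # sprout Z x @ sprout Z (flat us')) (map Letter (concat (r # rs)))"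
    using gen_sprout_prefix[OF P(1) g, of r] x(1) by (simp flip: sprout_simps(3))
  show ?case
  proof (cases "triv i x")
    case True
    have "gen P (Nonterm Z # sprout Z (flat us')) (map Letter (concat (r # rs)))"
      using gen_fold[OF P(2)[OF x(2) True], of "[]"] g' by simp
    with us' show ?thesis by blast
  next
    case False
    then have "reduced K triv ((i, x) # us')"
      using us' x(2) by (auto simp: reduced_def distinct_adj_Cons hd_map)
    with g' show ?thesis by (intro exI[of _ "(i, x) # us'"]) simp
  qed
qed

lemma inj_Letter: "inj Letter"
  by (simp add: inj_def)

text \<open>All that the grammar argument needs from a free product: \<open>compat\<close> says that
  the factors map into \<open>M\<close>, and \<open>free\<close> is uniqueness of normal forms.
  Presentations are absent since the letters of a combing need not be the presentation
  generators.\<close>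

locale free_factors =
  fixes N :: "bool \<Rightarrow> ('g, 'c) monoid_scheme" and B :: "bool \<Rightarrow> 'a set"
    and \<pi> :: "bool \<Rightarrow> 'a list \<Rightarrow> 'g" and R :: "bool \<Rightarrow> 'a list set"
    and M :: "('m, 'd) monoid_scheme" and \<rho> :: "'a list \<Rightarrow> 'm"
  assumes monoid_N: "monoid (N i)" and monoid_M: "monoid M"
    and gen_N: "generates_via (N i) (B i) (\<pi> i)"
    and combing: "regular_combing (N i) (B i) (\<pi> i) (R i)"
    and hyperbolic: "word_hyperbolic_wrt (N i) (\<pi> i) (R i)"
    and star: "kleene_star (R i) = R i"
    and disj: "B False \<inter> B True = {}"
    and gen_M: "generates_via M (B False \<union> B True) \<rho>"
    and compat: "u \<in> lists (B i) \<Longrightarrow> v \<in> lists (B i) \<Longrightarrow> \<pi> i u = \<pi> i v \<Longrightarrow> \<rho> u = \<rho> v"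
    and free: "reduced R (\<lambda>i p. \<pi> i p = \<one>\<^bsub>N i\<^esub>) us \<Longrightarrow> reduced R (\<lambda>i p. \<pi> i p = \<one>\<^bsub>N i\<^esub>) vs \<Longrightarrow>
      \<rho> (flat us) = \<rho> (flat vs) \<Longrightarrow> map (\<lambda>(i, p). (i, \<pi> i p)) us = map (\<lambda>(i, p). (i, \<pi> i p)) vs"
begin

interpretation M: monoid M by (rule monoid_M)

abbreviation "BB \<equiv> B False \<union> B True"
abbreviation "red \<equiv> reduced R (\<lambda>i p. \<pi> i p = \<one>\<^bsub>N i\<^esub>)"
abbreviation "T i \<equiv> {(u, v, w). u \<in> R i \<and> v \<in> R i \<and> w \<in> R i \<and> \<pi> i u \<otimes>\<^bsub>N i\<^esub> \<pi> i v = \<pi> i w}"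

lemma R_Nil: "[] \<in> R i"
  using kleene_star_Nil[of "R i"] star by simp

lemma R_append: "u \<in> R i \<Longrightarrow> v \<in> R i \<Longrightarrow> u @ v \<in> R i"
  using kleene_star_append[of u "R i" v] star by simp

lemma R_lists: "u \<in> R i \<Longrightarrow> u \<in> lists (B i)"
  using combing regular_language_lists unfolding regular_combing_def by blast

lemma B_lists: "u \<in> lists (B i) \<Longrightarrow> u \<in> lists BB"
  by (cases i) auto

lemma \<pi>_Nil: "\<pi> i [] = \<one>\<^bsub>N i\<^esub>"
  using gen_N[of i] by (simp add: generates_via_def)

lemma \<pi>_append: "u \<in> lists (B i) \<Longrightarrow> v \<in> lists (B i) \<Longrightarrow> \<pi> i (u @ v) = \<pi> i u \<otimes>\<^bsub>N i\<^esub> \<pi> i v"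
  using gen_N[of i] by (simp add: generates_via_def hom_def free_monoid_def)

lemma \<pi>_closed: "u \<in> lists (B i) \<Longrightarrow> \<pi> i u \<in> carrier (N i)"
  using gen_N[of i] unfolding generates_via_def by blast

lemma \<rho>_Nil: "\<rho> [] = \<one>\<^bsub>M\<^esub>"
  using gen_M by (simp add: generates_via_def)

lemma \<rho>_append: "u \<in> lists BB \<Longrightarrow> v \<in> lists BB \<Longrightarrow> \<rho> (u @ v) = \<rho> u \<otimes>\<^bsub>M\<^esub> \<rho> v"
  using gen_M by (simp add: generates_via_def hom_def free_monoid_def)

lemma \<rho>_closed: "u \<in> lists BB \<Longrightarrow> \<rho> u \<in> carrier M"
  using gen_M unfolding generates_via_def by blast

text \<open>
  Right-hand sides are entries of a multiplication table of a factor, with nonterminals in place of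
  one or both separators. Only entries whose components are words over \<open>U\<close>, \<open>V\<close>, \<open>W\<close> are used, so
  the empty alphabet forces the corresponding component to be empty.
\<close>

definition rhs :: "bool \<Rightarrow> 'a set \<Rightarrow> 'a set \<Rightarrow> 'a set \<Rightarrow> (nonterm, 'a marked) gsym list \<Rightarrow>
    (nonterm, 'a marked) gsym list \<Rightarrow> (nonterm, 'a marked) gsym list set" where
  "rhs i U V W x y = {sprout One u @ x @ sprout One v @ y @ sprout OneRev (rev w) |
     u v w. (u, v, w) \<in> T i \<and> u \<in> lists U \<and> v \<in> lists V \<and> w \<in> lists W}"

text \<open>The six families are equations in one factor: \<open>v = 1\<close>,
  \<open>w = 1\<close>, \<open>uv = 1\<close>, \<open>v = w\<close>, \<open>u = w\<close> and
  \<open>uv = w\<close>. The last is the only way to end a \<open>Prod\<close> chain, so it is used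
  exactly once; with empty words it also covers products in which no two blocks meet.\<close>

definition rules :: "(nonterm \<times> (nonterm, 'a marked) gsym list set) list" where
  "rules =
    [(One, {[]}), (OneRev, {[]}), (Cancel, {[Term Hash1, Nonterm One]}),
     (Match, {[Term Hash2, Nonterm OneRev]}), (Start, {[Nonterm One, Nonterm Prod]})] @
    concat (map (\<lambda>i.
      [(One, rhs i {} (B i) {} [Nonterm One] []),
       (OneRev, rhs i {} {} (B i) [Nonterm OneRev] []),
       (Cancel, rhs i (B i) (B i) {} [Nonterm Cancel] []),
       (Match, rhs i {} (B i) (B i) [] [Nonterm Match]),
       (Prod, rhs i (B i) {} (B i) [Nonterm Prod] []),
       (Prod, rhs i (B i) (B i) (B i) [Nonterm Cancel] [Nonterm Match])]) [False, True])"

definition prods :: "(nonterm \<times> (nonterm, 'a marked) gsym list) set" where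
  "prods = {(X, \<alpha>). \<exists>L. (X, L) \<in> set rules \<and> \<alpha> \<in> L}"

text \<open>Each \<open>sprout\<close> replaces a letter by two symbols, so the set is a
  componentwise substitution image of the table of one factor.\<close>

lemma context_free_rhs:
  assumes "U \<subseteq> B i" "V \<subseteq> B i" "W \<subseteq> B i"
  shows "context_free_language (rhs i U V W x y)"
proof -
  have "context_free_language (table (T i))"
    using hyperbolic[of i] unfolding word_hyperbolic_wrt_def mult_table_eq .
  moreover have "finite (B i)"
    using gen_N[of i] by (simp add: generates_via_def)
  ultimately show ?thesis
    unfolding rhs_def sprout_def using assms by (intro context_free_table_subst) (auto intro: finite_subset)
qed

lemma context_free_prods: "context_free_language {w. gen prods [Nonterm X] w}"
  unfolding prods_def
  by (rule context_free_nested)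
     (auto simp: rules_def intro: context_free_rhs context_free_singleton)

lemma prodsI: "(X, L) \<in> set rules \<Longrightarrow> \<alpha> \<in> L \<Longrightarrow> (X, \<alpha>) \<in> prods"
  unfolding prods_def by blast

lemma prods_empty: "(One, []) \<in> prods" "(OneRev, []) \<in> prods"
  and prods_hash: "(Cancel, [Term Hash1, Nonterm One]) \<in> prods"
    "(Match, [Term Hash2, Nonterm OneRev]) \<in> prods"
  and prods_Start: "(Start, [Nonterm One, Nonterm Prod]) \<in> prods"
  by (rule prodsI[of _ "{_}"]; simp add: rules_def)+

lemma rules_rhs:
  "(One, rhs i {} (B i) {} [Nonterm One] []) \<in> set rules"
  "(OneRev, rhs i {} {} (B i) [Nonterm OneRev] []) \<in> set rules"
  "(Cancel, rhs i (B i) (B i) {} [Nonterm Cancel] []) \<in> set rules"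
  "(Match, rhs i {} (B i) (B i) [] [Nonterm Match]) \<in> set rules"
  "(Prod, rhs i (B i) {} (B i) [Nonterm Prod] []) \<in> set rules"
  "(Prod, rhs i (B i) (B i) (B i) [Nonterm Cancel] [Nonterm Match]) \<in> set rules"
  by (cases i; simp add: rules_def)+

lemma rhsI:
  assumes "u \<in> R i" "v \<in> R i" "w \<in> R i" "\<pi> i (u @ v) = \<pi> i w"
    "u \<in> lists U" "v \<in> lists V" "w \<in> lists W"
    "\<alpha> = sprout One u @ x @ sprout One v @ y @ sprout OneRev (rev w)"
  shows "\<alpha> \<in> rhs i U V W x y"
  using assms \<pi>_append[OF R_lists R_lists, OF assms(1,2)] unfolding rhs_def by auto

lemma prods_One: "v \<in> R i \<Longrightarrow> \<pi> i v = \<one>\<^bsub>N i\<^esub> \<Longrightarrow> (One, Nonterm One # sprout One v) \<in> prods"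
  by (rule prodsI[OF rules_rhs(1)[of i]], rule rhsI[of "[]" _ v "[]"])
     (simp_all add: R_Nil \<pi>_Nil R_lists)

lemma prods_OneRev:
  "w \<in> R i \<Longrightarrow> \<pi> i w = \<one>\<^bsub>N i\<^esub> \<Longrightarrow> (OneRev, Nonterm OneRev # sprout OneRev (rev w)) \<in> prods"
  by (rule prodsI[OF rules_rhs(2)[of i]], rule rhsI[of "[]" _ "[]" w])
     (simp_all add: R_Nil \<pi>_Nil R_lists)

lemma prods_Cancel:
  "u \<in> R i \<Longrightarrow> v \<in> R i \<Longrightarrow> \<pi> i (u @ v) = \<one>\<^bsub>N i\<^esub> \<Longrightarrow>
    (Cancel, sprout One u @ Nonterm Cancel # sprout One v) \<in> prods"
  by (rule prodsI[OF rules_rhs(3)[of i]], rule rhsI[of u _ v "[]"])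
     (simp_all add: R_Nil \<pi>_Nil R_lists)

lemma prods_Match:
  "v \<in> R i \<Longrightarrow> w \<in> R i \<Longrightarrow> \<pi> i v = \<pi> i w \<Longrightarrow>
    (Match, sprout One v @ Nonterm Match # sprout OneRev (rev w)) \<in> prods"
  by (rule prodsI[OF rules_rhs(4)[of i]], rule rhsI[of "[]" _ v w])
     (simp_all add: R_Nil \<pi>_Nil R_lists)

lemma prods_Prod:
  "u \<in> R i \<Longrightarrow> w \<in> R i \<Longrightarrow> \<pi> i u = \<pi> i w \<Longrightarrow>
    (Prod, sprout One u @ Nonterm Prod # sprout OneRev (rev w)) \<in> prods"
  by (rule prodsI[OF rules_rhs(5)[of i]], rule rhsI[of u _ "[]" w])
     (simp_all add: R_Nil \<pi>_Nil R_lists)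

lemma prods_center:
  "u \<in> R i \<Longrightarrow> v \<in> R i \<Longrightarrow> w \<in> R i \<Longrightarrow> \<pi> i (u @ v) = \<pi> i w \<Longrightarrow>
    (Prod, sprout One u @ Nonterm Cancel # sprout One v @ Nonterm Match # sprout OneRev (rev w)) \<in> prods"
  by (rule prodsI[OF rules_rhs(6)[of i]], rule rhsI[of u _ v w])
     (simp_all add: R_Nil \<pi>_Nil R_lists)

section \<open>Soundness: only true equations are derived\<close>

abbreviation "TT \<equiv> {(u, v, w). u \<in> lists BB \<and> v \<in> lists BB \<and> w \<in> lists BB \<and> \<rho> (u @ v) = \<rho> w}"

text \<open>Upper bounds for the generated languages. They speak of all words over the joint
  alphabet, because filled slots can lead outside the combing.\<close>

primrec meaning :: "nonterm \<Rightarrow> 'a marked list set" where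
  "meaning One = {map Letter u | u. u \<in> lists BB \<and> \<rho> u = \<one>\<^bsub>M\<^esub>}"
| "meaning OneRev = {map Letter (rev u) | u. u \<in> lists BB \<and> \<rho> u = \<one>\<^bsub>M\<^esub>}"
| "meaning Cancel = {map Letter u @ [Hash1] @ map Letter v | u v.
     u \<in> lists BB \<and> v \<in> lists BB \<and> \<rho> (u @ v) = \<one>\<^bsub>M\<^esub>}"
| "meaning Match = {map Letter v @ [Hash2] @ map Letter (rev w) | v w.
     v \<in> lists BB \<and> w \<in> lists BB \<and> \<rho> v = \<rho> w}"
| "meaning Prod = table TT"
| "meaning Start = table TT"

text \<open>Filling the slots inserts words of value one, which disappear under
  \<open>\<rho>\<close>.\<close>

lemma word_lang_sprout:
  assumes "x \<in> word_lang meaning (sprout One u)" "u \<in> lists BB"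
  obtains u' where "x = map Letter u'" "u' \<in> lists BB" "\<rho> u' = \<rho> u"
proof -
  have "\<exists>u'. x = map Letter u' \<and> u' \<in> lists BB \<and> \<rho> u' = \<rho> u"
    using assms
  proof (induction u arbitrary: x)
    case (Cons c u)
    then obtain e y where e: "x = Letter c # map Letter e @ y" "y \<in> word_lang meaning (sprout One u)"
        "e \<in> lists BB" "\<rho> e = \<one>\<^bsub>M\<^esub>"
      by (auto simp del: map_map)
    with Cons.IH[OF e(2)] Cons.prems obtain u' where u': "y = map Letter u'" "u' \<in> lists BB" "\<rho> u' = \<rho> u"
      by auto
    have "[c] \<in> lists BB" "u \<in> lists BB" using Cons.prems by auto
    with e u' have "\<rho> ([c] @ e @ u') = \<rho> ([c] @ u)"
      by (simp only: \<rho>_append append_in_lists_conv) (simp add: \<rho>_closed)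
    with e u' Cons.prems show ?case by (intro exI[of _ "c # e @ u'"]) auto
  qed auto
  then show ?thesis using that by blast
qed

text \<open>A slot behind a letter of the reversed word lies in front of that letter in
  \<open>w\<close>, which explains the order in the witness \<open>w' @ e @ [c]\<close>.\<close>

lemma word_lang_sprout_rev:
  assumes "x \<in> word_lang meaning (sprout OneRev (rev w))" "w \<in> lists BB"
  obtains w' where "x = map Letter (rev w')" "w' \<in> lists BB" "\<rho> w' = \<rho> w"
proof -
  have "\<exists>w'. x = map Letter (rev w') \<and> w' \<in> lists BB \<and> \<rho> w' = \<rho> w"
    using assms
  proof (induction w arbitrary: x rule: rev_induct)
    case (snoc c w)
    then obtain e y where e: "x = Letter c # map Letter (rev e) @ y"
        "y \<in> word_lang meaning (sprout OneRev (rev w))" "e \<in> lists BB" "\<rho> e = \<one>\<^bsub>M\<^esub>"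
      by (auto simp del: map_map)
    with snoc.IH[OF e(2)] snoc.prems obtain w' where w': "y = map Letter (rev w')" "w' \<in> lists BB" "\<rho> w' = \<rho> w"
      by auto
    have "[c] \<in> lists BB" "w \<in> lists BB" using snoc.prems by auto
    with e w' have "\<rho> (w' @ e @ [c]) = \<rho> (w @ [c])"
      by (simp only: \<rho>_append append_in_lists_conv) (simp add: \<rho>_closed)
    with e w' snoc.prems show ?case by (intro exI[of _ "w' @ e @ [c]"]) auto
  qed auto
  then show ?thesis using that by blast
qed

lemma word_lang_NontermE:
  assumes "x \<in> word_lang V (\<alpha> @ Nonterm X # \<beta>)"
  obtains y m z where "x = y @ m @ z" "y \<in> word_lang V \<alpha>" "m \<in> V X" "z \<in> word_lang V \<beta>"
  using assms unfolding word_lang_append by auto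

text \<open>Each production wraps an equation of one factor around equations that already hold in
  \<open>M\<close>, and substituting the inner ones gives the new one.\<close>

lemma prods_meaning:
  assumes "(X, \<alpha>) \<in> prods"
  shows "word_lang meaning \<alpha> \<subseteq> meaning X"
proof -
  \<comment> \<open>Table entries of a factor become equations of \<open>M\<close> through
    \<open>compat\<close>.\<close>
  have T_\<rho>: "\<rho> u \<otimes>\<^bsub>M\<^esub> \<rho> v = \<rho> w" "u \<in> lists BB" "v \<in> lists BB" "w \<in> lists BB"
    if "(u, v, w) \<in> T i" for i u v w
  proof -
    have "u \<in> lists (B i)" "v \<in> lists (B i)" "w \<in> lists (B i)" "\<pi> i (u @ v) = \<pi> i w"
      using that R_lists \<pi>_append by auto
    then show "\<rho> u \<otimes>\<^bsub>M\<^esub> \<rho> v = \<rho> w" "u \<in> lists BB" "v \<in> lists BB" "w \<in> lists BB"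
      using compat[of "u @ v" i w] B_lists[of _ i] \<rho>_append[of u v] by auto
  qed
  note simps = word_lang_append \<rho>_append \<rho>_closed \<rho>_Nil
  from assms obtain L where L: "(X, L) \<in> set rules" "\<alpha> \<in> L"
    unfolding prods_def by blast
  then consider (eps) "X \<in> {One, OneRev}" "\<alpha> = []"
    | (cancel) "X = Cancel" "\<alpha> = [Term Hash1, Nonterm One]"
    | (match) "X = Match" "\<alpha> = [Term Hash2, Nonterm OneRev]"
    | (start) "X = Start" "\<alpha> = [Nonterm One, Nonterm Prod]"
    | (one) i where "X = One" "\<alpha> \<in> rhs i {} (B i) {} [Nonterm One] []"
    | (onerev) i where "X = OneRev" "\<alpha> \<in> rhs i {} {} (B i) [Nonterm OneRev] []"
    | (Cancel) i where "X = Cancel" "\<alpha> \<in> rhs i (B i) (B i) {} [Nonterm Cancel] []"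
    | (Match) i where "X = Match" "\<alpha> \<in> rhs i {} (B i) (B i) [] [Nonterm Match]"
    | (Prod) i where "X = Prod" "\<alpha> \<in> rhs i (B i) {} (B i) [Nonterm Prod] []"
    | (center) i where "X = Prod" "\<alpha> \<in> rhs i (B i) (B i) (B i) [Nonterm Cancel] [Nonterm Match]"
    unfolding rules_def by auto
  then show ?thesis
  proof cases
    case eps
    then show ?thesis by (auto simp: \<rho>_Nil)
  next
    case cancel
    show ?thesis unfolding cancel
      by (force intro: exI[of _ "[]"])
  next
    case match
    show ?thesis unfolding match
      by (force simp: \<rho>_Nil intro: exI[of _ "[]"])
  next
    case start
    show ?thesis
    proof
      fix x assume "x \<in> word_lang meaning \<alpha>"
      then obtain e u v w where x: "x = map Letter (e @ u) @ [Hash1] @ map Letter v @ [Hash2] @ map Letter (rev w)"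
        and *: "e \<in> lists BB" "u \<in> lists BB" "v \<in> lists BB" "w \<in> lists BB"
          "\<rho> e = \<one>\<^bsub>M\<^esub>" "\<rho> (u @ v) = \<rho> w"
        unfolding start by (auto simp: table_def)
      have "\<rho> ((e @ u) @ v) = \<rho> w"
        using * \<rho>_append[of e "u @ v"] by (simp add: \<rho>_closed)
      then show "x \<in> meaning X"
        unfolding start meaning.simps table_def x using *
        by (intro CollectI exI[of _ "e @ u"] exI[of _ v] exI[of _ w]) simp
    qed
  next
    case one
    then obtain v where \<alpha>: "\<alpha> = Nonterm One # sprout One v" "(([], v, []) \<in> T i)"
      unfolding rhs_def by auto
    show ?thesis
    proof
      fix x assume "x \<in> word_lang meaning \<alpha>"
      then obtain e y where x: "x = map Letter e @ y" "e \<in> lists BB" "\<rho> e = \<one>\<^bsub>M\<^esub>"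
          "y \<in> word_lang meaning (sprout One v)"
        unfolding \<alpha> by auto
      from word_lang_sprout[OF x(4)] T_\<rho>[OF \<alpha>(2)] obtain v'
        where v': "y = map Letter v'" "v' \<in> lists BB" "\<rho> v' = \<one>\<^bsub>M\<^esub>"
        using \<rho>_closed by (auto simp: \<rho>_Nil)
      have "\<rho> (e @ v') = \<one>\<^bsub>M\<^esub>" using x v' by (simp add: \<rho>_append)
      then show "x \<in> meaning X" using one(1) x v' by (auto intro!: exI[of _ "e @ v'"])
    qed
  next
    case onerev
    then obtain w where \<alpha>: "\<alpha> = Nonterm OneRev # sprout OneRev (rev w)" "(([], [], w) \<in> T i)"
      unfolding rhs_def by auto
    show ?thesis
    proof
      fix x assume "x \<in> word_lang meaning \<alpha>"
      then obtain e y where x: "x = map Letter (rev e) @ y" "e \<in> lists BB" "\<rho> e = \<one>\<^bsub>M\<^esub>"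
          "y \<in> word_lang meaning (sprout OneRev (rev w))"
        unfolding \<alpha> by auto
      from word_lang_sprout_rev[OF x(4)] T_\<rho>[OF \<alpha>(2)] obtain w'
        where w': "y = map Letter (rev w')" "w' \<in> lists BB" "\<rho> w' = \<one>\<^bsub>M\<^esub>"
        using \<rho>_closed by (auto simp: \<rho>_Nil)
      have "\<rho> (w' @ e) = \<one>\<^bsub>M\<^esub>" using x w' by (simp add: \<rho>_append)
      then show "x \<in> meaning X" using onerev(1) x w' by (auto intro!: exI[of _ "w' @ e"])
    qed
  next
    case Cancel
    then obtain u v where \<alpha>: "\<alpha> = sprout One u @ Nonterm Cancel # sprout One v" "((u, v, []) \<in> T i)"
      unfolding rhs_def by auto
    note T = T_\<rho>[OF \<alpha>(2)]
    show ?thesis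
    proof
      fix x assume "x \<in> word_lang meaning \<alpha>"
      then obtain y m z where "x = y @ m @ z" "y \<in> word_lang meaning (sprout One u)"
          "m \<in> meaning Cancel" "z \<in> word_lang meaning (sprout One v)"
        unfolding \<alpha> by (rule word_lang_NontermE)
      moreover from this(3) obtain a b where "m = map Letter a @ [Hash1] @ map Letter b"
          "a \<in> lists BB" "b \<in> lists BB" "\<rho> (a @ b) = \<one>\<^bsub>M\<^esub>"
        by auto
      ultimately obtain y a b z where x: "x = y @ map Letter a @ [Hash1] @ map Letter b @ z"
          "y \<in> word_lang meaning (sprout One u)" "z \<in> word_lang meaning (sprout One v)"
          "a \<in> lists BB" "b \<in> lists BB" "\<rho> (a @ b) = \<one>\<^bsub>M\<^esub>"
        using that by simp
      obtain u' where u': "y = map Letter u'" "u' \<in> lists BB" "\<rho> u' = \<rho> u"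
        using word_lang_sprout[OF x(2) T(2)] .
      obtain v' where v': "z = map Letter v'" "v' \<in> lists BB" "\<rho> v' = \<rho> v"
        using word_lang_sprout[OF x(3) T(3)] .
      \<comment> \<open>Regrouped so that the inner pair \<open>a @ b\<close>, trivial by the
        meaning of \<open>Cancel\<close>, drops out.\<close>
      have "\<rho> ((u' @ a) @ (b @ v')) = \<rho> u' \<otimes>\<^bsub>M\<^esub> \<rho> (a @ b) \<otimes>\<^bsub>M\<^esub> \<rho> v'"
        using x(4,5) u'(2) v'(2) by (simp add: \<rho>_append \<rho>_closed M.m_assoc del: append_assoc)
      also have "\<dots> = \<one>\<^bsub>M\<^esub>" using x u' v' T by (simp add: \<rho>_closed \<rho>_Nil)
      finally show "x \<in> meaning X"
        unfolding Cancel(1) meaning.simps x(1) u'(1) v'(1) using x u' v'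
        by (intro CollectI exI[of _ "u' @ a"] exI[of _ "b @ v'"]) simp
    qed
  next
    case Match
    then obtain v w where \<alpha>: "\<alpha> = sprout One v @ Nonterm Match # sprout OneRev (rev w)" "(([], v, w) \<in> T i)"
      unfolding rhs_def by auto
    note T = T_\<rho>[OF \<alpha>(2)]
    show ?thesis
    proof
      fix x assume "x \<in> word_lang meaning \<alpha>"
      then obtain y m z where "x = y @ m @ z" "y \<in> word_lang meaning (sprout One v)"
          "m \<in> meaning Match" "z \<in> word_lang meaning (sprout OneRev (rev w))"
        unfolding \<alpha> by (rule word_lang_NontermE)
      moreover from this(3) obtain a b where "m = map Letter a @ [Hash2] @ map Letter (rev b)"
          "a \<in> lists BB" "b \<in> lists BB" "\<rho> a = \<rho> b"
        by auto
      ultimately obtain y a b z where x: "x = y @ map Letter a @ [Hash2] @ map Letter (rev b) @ z"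
          "y \<in> word_lang meaning (sprout One v)" "z \<in> word_lang meaning (sprout OneRev (rev w))"
          "a \<in> lists BB" "b \<in> lists BB" "\<rho> a = \<rho> b"
        using that by simp
      obtain v' where v': "y = map Letter v'" "v' \<in> lists BB" "\<rho> v' = \<rho> v"
        using word_lang_sprout[OF x(2) T(3)] .
      obtain w' where w': "z = map Letter (rev w')" "w' \<in> lists BB" "\<rho> w' = \<rho> w"
        using word_lang_sprout_rev[OF x(3) T(4)] .
      have "\<rho> (v' @ a) = \<rho> (w' @ b)"
        using x v' w' T by (simp add: \<rho>_append \<rho>_closed \<rho>_Nil)
      then show "x \<in> meaning X"
        unfolding Match(1) meaning.simps x(1) v'(1) w'(1) using x v' w'
        by (intro CollectI exI[of _ "v' @ a"] exI[of _ "w' @ b"]) simp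
    qed
  next
    case Prod
    then obtain u w where \<alpha>: "\<alpha> = sprout One u @ Nonterm Prod # sprout OneRev (rev w)" "((u, [], w) \<in> T i)"
      unfolding rhs_def by auto
    note T = T_\<rho>[OF \<alpha>(2)]
    show ?thesis
    proof
      fix x assume "x \<in> word_lang meaning \<alpha>"
      then obtain y m z where "x = y @ m @ z" "y \<in> word_lang meaning (sprout One u)"
          "m \<in> meaning Prod" "z \<in> word_lang meaning (sprout OneRev (rev w))"
        unfolding \<alpha> by (rule word_lang_NontermE)
      moreover from this(3) obtain a b c
        where "m = map Letter a @ [Hash1] @ map Letter b @ [Hash2] @ map Letter (rev c)"
          "a \<in> lists BB" "b \<in> lists BB" "c \<in> lists BB" "\<rho> (a @ b) = \<rho> c"
        by (auto simp: table_def)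
      ultimately obtain y a b c z where x:
          "x = y @ map Letter a @ [Hash1] @ map Letter b @ [Hash2] @ map Letter (rev c) @ z"
          "y \<in> word_lang meaning (sprout One u)" "z \<in> word_lang meaning (sprout OneRev (rev w))"
          "a \<in> lists BB" "b \<in> lists BB" "c \<in> lists BB" "\<rho> (a @ b) = \<rho> c"
        using that by simp
      obtain u' where u': "y = map Letter u'" "u' \<in> lists BB" "\<rho> u' = \<rho> u"
        using word_lang_sprout[OF x(2) T(2)] .
      obtain w' where w': "z = map Letter (rev w')" "w' \<in> lists BB" "\<rho> w' = \<rho> w"
        using word_lang_sprout_rev[OF x(3) T(4)] .
      have "\<rho> ((u' @ a) @ b) = \<rho> u' \<otimes>\<^bsub>M\<^esub> \<rho> (a @ b)"
        using x u' by (simp add: \<rho>_append \<rho>_closed)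
      also have "\<dots> = \<rho> (w' @ c)"
        using x u' w' T by (simp add: \<rho>_append \<rho>_closed \<rho>_Nil)
      finally show "x \<in> meaning X"
        unfolding Prod(1) meaning.simps table_def x(1) u'(1) w'(1) using x u' w'
        by (intro CollectI exI[of _ "u' @ a"] exI[of _ b] exI[of _ "w' @ c"]) simp
    qed
  next
    case center
    then obtain u v w where \<alpha>: "(u, v, w) \<in> T i"
        "\<alpha> = sprout One u @ Nonterm Cancel # sprout One v @ Nonterm Match # sprout OneRev (rev w)"
      unfolding rhs_def by auto
    note T = T_\<rho>[OF \<alpha>(1)]
    show ?thesis
    proof
      fix x assume "x \<in> word_lang meaning \<alpha>"
      then obtain y m z' where m: "x = y @ m @ z'" "y \<in> word_lang meaning (sprout One u)"
          "m \<in> meaning Cancel"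
          "z' \<in> word_lang meaning (sprout One v @ Nonterm Match # sprout OneRev (rev w))"
        unfolding \<alpha>(2) by (rule word_lang_NontermE)
      moreover from m(4) obtain t n z where "z' = t @ n @ z" "t \<in> word_lang meaning (sprout One v)"
          "n \<in> meaning Match" "z \<in> word_lang meaning (sprout OneRev (rev w))"
        by (rule word_lang_NontermE)
      moreover from m(3) obtain a b where "m = map Letter a @ [Hash1] @ map Letter b"
          "a \<in> lists BB" "b \<in> lists BB" "\<rho> (a @ b) = \<one>\<^bsub>M\<^esub>"
        by auto
      moreover from \<open>n \<in> meaning Match\<close> obtain c d where "n = map Letter c @ [Hash2] @ map Letter (rev d)"
          "c \<in> lists BB" "d \<in> lists BB" "\<rho> c = \<rho> d"
        by auto
      ultimately obtain y a b t c d z where x: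
          "x = y @ map Letter a @ [Hash1] @ map Letter b @ t @ map Letter c @ [Hash2] @ map Letter (rev d) @ z"
          "y \<in> word_lang meaning (sprout One u)" "t \<in> word_lang meaning (sprout One v)"
          "z \<in> word_lang meaning (sprout OneRev (rev w))"
          "a \<in> lists BB" "b \<in> lists BB" "c \<in> lists BB" "d \<in> lists BB"
          "\<rho> (a @ b) = \<one>\<^bsub>M\<^esub>" "\<rho> c = \<rho> d"
        using that by simp
      obtain u' where u': "y = map Letter u'" "u' \<in> lists BB" "\<rho> u' = \<rho> u"
        using word_lang_sprout[OF x(2) T(2)] .
      obtain v' where v': "t = map Letter v'" "v' \<in> lists BB" "\<rho> v' = \<rho> v"
        using word_lang_sprout[OF x(3) T(3)] .
      obtain w' where w': "z = map Letter (rev w')" "w' \<in> lists BB" "\<rho> w' = \<rho> w"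
        using word_lang_sprout_rev[OF x(4) T(4)] .
      have "\<rho> ((u' @ a) @ (b @ v' @ c)) = \<rho> u' \<otimes>\<^bsub>M\<^esub> \<rho> (a @ b) \<otimes>\<^bsub>M\<^esub> \<rho> v' \<otimes>\<^bsub>M\<^esub> \<rho> c"
        using x(5-7) u'(2) v'(2) by (simp add: \<rho>_append \<rho>_closed M.m_assoc del: append_assoc)
      also have "\<dots> = \<rho> (w' @ d)"
        using x u' v' w' T by (simp add: \<rho>_append \<rho>_closed)
      finally show "x \<in> meaning X"
        unfolding center(1) meaning.simps table_def x(1) u'(1) v'(1) w'(1) using x u' v' w'
        by (intro CollectI exI[of _ "u' @ a"] exI[of _ "b @ v' @ c"] exI[of _ "w' @ d"]) simp
    qed
  qed
qed

lemma gen_meaning: "gen prods s x \<Longrightarrow> x \<in> word_lang meaning s"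
  by (rule gen_imp_word_lang[OF prods_meaning])

section \<open>Completeness: contracting reduced sequences\<close>

abbreviation "val \<equiv> map (\<lambda>(i, p). (i, \<pi> i p))"

text \<open>Reversal puts the first block of \<open>ws\<close> last, so the blocks of
  \<open>us\<close> and \<open>ws\<close> pair up like brackets around \<open>X\<close>; the inner
  pairs are contracted before the outer one. The symbol \<open>X\<close> will be
  \<open>Match\<close> or \<open>Prod\<close>.\<close>

lemma fold_pairs:
  assumes rule: "\<And>i p q. p \<in> R i \<Longrightarrow> q \<in> R i \<Longrightarrow> \<pi> i p = \<pi> i q \<Longrightarrow>
      (X, sprout One p @ Nonterm X # sprout OneRev (rev q)) \<in> prods"
    and "red us" "red ws" "val us = val ws"
    and "gen prods (l @ sprout One (flat us) @ Nonterm X # sprout OneRev (rev (flat ws)) @ r) x"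
  shows "gen prods (l @ Nonterm X # r) x"
proof -
  have "\<forall>(i, p)\<in>set us. p \<in> R i" "\<forall>(i, p)\<in>set ws. p \<in> R i"
    using assms(2,3) unfolding reduced_def by auto
  then show ?thesis
    using assms(4,5)
  proof (induction us arbitrary: ws l r)
    case (Cons b us)
    obtain i p where b: "b = (i, p)" by fastforce
    with Cons.prems(3) obtain q ws' where ws: "ws = (i, q) # ws'" "\<pi> i p = \<pi> i q" "val us = val ws'"
      by auto
    have R: "p \<in> R i" "q \<in> R i" using Cons.prems(1,2) b ws by auto
    have "gen prods ((l @ sprout One p) @ sprout One (flat us) @ Nonterm X #
        sprout OneRev (rev (flat ws')) @ sprout OneRev (rev q) @ r) x"
      using Cons.prems(4) b ws(1) by simp
    then have "gen prods ((l @ sprout One p) @ Nonterm X # sprout OneRev (rev q) @ r) x"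
      using Cons.prems(1,2) ws by (intro Cons.IH) auto
    then show ?case
      using gen_fold[OF rule[OF R ws(2)], of l r x] by simp
  qed simp
qed

lemma red_flat: "red us \<Longrightarrow> flat us \<in> lists BB"
  using R_lists B_lists unfolding flat_def reduced_def by fastforce

text \<open>Facing blocks of the same factor with product one are contracted into
  \<open>Cancel\<close> until this is no longer possible; the last clause records that the process
  has stopped. Initial and final segments of reduced sequences stay reduced.\<close>

lemma cancel_middle:
  "red us \<Longrightarrow> red vs \<Longrightarrow> \<exists>us' vs'. red us' \<and> red vs' \<and>
    \<rho> (flat us @ flat vs) = \<rho> (flat us' @ flat vs') \<and>
    (\<forall>l r x. gen prods (l @ sprout One (flat us) @ Nonterm Cancel # sprout One (flat vs) @ r) x \<longrightarrow>
      gen prods (l @ sprout One (flat us') @ Nonterm Cancel # sprout One (flat vs') @ r) x) \<and>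
    (\<forall>i p q us'' vs''. us' = us'' @ [(i, p)] \<longrightarrow> vs' = (i, q) # vs'' \<longrightarrow> \<pi> i (p @ q) \<noteq> \<one>\<^bsub>N i\<^esub>)"
proof (induction us arbitrary: vs rule: rev_induct)
  case Nil
  then show ?case by (intro exI[of _ "[]"] exI[of _ vs]) auto
next
  case (snoc b us)
  obtain i p where b: "b = (i, p)" by fastforce
  show ?case
  proof (cases "\<exists>q vs'. vs = (i, q) # vs' \<and> \<pi> i (p @ q) = \<one>\<^bsub>N i\<^esub>")
    case False
    then show ?thesis
      using snoc.prems b by (intro exI[of _ "us @ [b]"] exI[of _ vs]) auto
  next
    case True
    then obtain q vs' where vs: "vs = (i, q) # vs'" "\<pi> i (p @ q) = \<one>\<^bsub>N i\<^esub>" by blast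
    have R: "p \<in> R i" "q \<in> R i" using snoc.prems b vs by (auto simp: reduced_def)
    have red: "red us" "red vs'"
      using snoc.prems vs by (auto simp: reduced_def distinct_adj_append_iff distinct_adj_Cons)
    have "\<rho> (p @ q) = \<one>\<^bsub>M\<^esub>"
      using compat[of "p @ q" i "[]"] R vs(2) R_lists by (auto simp: \<pi>_Nil \<rho>_Nil)
    then have "\<rho> (flat us @ (p @ q) @ flat vs') = \<rho> (flat us @ flat vs')"
      using red_flat[OF red(1)] red_flat[OF red(2)] B_lists[OF R_lists[OF R(1)]] B_lists[OF R_lists[OF R(2)]]
        \<rho>_append[of "flat us" "(p @ q) @ flat vs'"] \<rho>_append[of "p @ q" "flat vs'"]
        \<rho>_append[of "flat us" "flat vs'"]
      by (simp add: \<rho>_closed)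
    then have \<rho>: "\<rho> (flat (us @ [b]) @ flat vs) = \<rho> (flat us @ flat vs')"
      using b vs by simp
    have "gen prods (l @ sprout One (flat us) @ Nonterm Cancel # sprout One (flat vs') @ r) x"
      if "gen prods (l @ sprout One (flat (us @ [b])) @ Nonterm Cancel # sprout One (flat vs) @ r) x"
      for l r x
      using gen_fold[OF prods_Cancel[OF R vs(2)], of "l @ sprout One (flat us)" "sprout One (flat vs') @ r"]
        that b vs by simp
    with snoc.IH[OF red] \<rho> show ?thesis by (metis (no_types, lifting))
  qed
qed

text \<open>After cancellation the remains of \<open>us\<close> and \<open>vs\<close> form a reduced
  sequence, up to merging one pair of facing blocks. By \<open>free\<close> its values are those of
  \<open>ws\<close>, which dictates how \<open>ws\<close> splits.\<close>

lemma gen_Start: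
  assumes red: "red us" "red vs" "red ws"
    and eq: "\<rho> (flat us @ flat vs) = \<rho> (flat ws)"
    and g: "gen prods (Nonterm One # sprout One (flat us) @ Nonterm Cancel # sprout One (flat vs) @
      Nonterm Match # sprout OneRev (rev (flat ws))) x"
  shows "gen prods [Nonterm Start] x"
proof -
  obtain us' vs' where red': "red us'" "red vs'"
    and eq': "\<rho> (flat us' @ flat vs') = \<rho> (flat ws)"
    and g': "gen prods (Nonterm One # sprout One (flat us') @ Nonterm Cancel # sprout One (flat vs') @
      Nonterm Match # sprout OneRev (rev (flat ws))) x"
    and nt: "\<And>i p q us'' vs''. us' = us'' @ [(i, p)] \<Longrightarrow> vs' = (i, q) # vs'' \<Longrightarrow> \<pi> i (p @ q) \<noteq> \<one>\<^bsub>N i\<^esub>"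
    using cancel_middle[OF red(1,2)] eq g by (metis (no_types, lifting) append_Cons append_Nil)
  \<comment> \<open>A common shape for both cases: \<open>p\<close> and \<open>q\<close> meet in the
    block \<open>r\<close> of \<open>ws\<close>, where all three may be empty.\<close>
  have "\<exists>us1 i p q r vs1 ws1 ws2. red us1 \<and> red vs1 \<and> red ws1 \<and> red ws2 \<and>
      p \<in> R i \<and> q \<in> R i \<and> r \<in> R i \<and> \<pi> i (p @ q) = \<pi> i r \<and> val us1 = val ws1 \<and> val vs1 = val ws2 \<and>
      flat us' = flat us1 @ p \<and> flat vs' = q @ flat vs1 \<and> flat ws = flat ws1 @ r @ flat ws2"
  proof (cases "\<exists>i p q us'' vs''. us' = us'' @ [(i, p)] \<and> vs' = (i, q) # vs''")
    case True
    then obtain i p q us1 vs1 where d: "us' = us1 @ [(i, p)]" "vs' = (i, q) # vs1" by blast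
    have R: "p \<in> R i" "q \<in> R i" using red' d by (auto simp: reduced_def)
    \<comment> \<open>The merged block lies in \<open>R i\<close> by closure under concatenation and
      is nontrivial because cancellation has stopped.\<close>
    have "red (us1 @ (i, p @ q) # vs1)"
      using red' R_append nt[OF d] unfolding d
      by (auto simp: reduced_def distinct_adj_append_iff distinct_adj_Cons)
    moreover have "\<rho> (flat (us1 @ (i, p @ q) # vs1)) = \<rho> (flat ws)"
      using eq' d by simp
    ultimately have "val (us1 @ (i, p @ q) # vs1) = val ws"
      using red(3) free by blast
    then have "val ws = val us1 @ (i, \<pi> i (p @ q)) # val vs1" by simp
    then obtain ws1 r ws2 where ws: "ws = ws1 @ (i, r) # ws2" "val us1 = val ws1"
        "\<pi> i (p @ q) = \<pi> i r" "val vs1 = val ws2"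
      by (auto simp: map_eq_append_conv map_eq_Cons_conv)
    have "r \<in> R i" "red ws1" "red ws2" "red us1" "red vs1"
      using red(3) red' unfolding ws(1) d
      by (auto simp: reduced_def distinct_adj_append_iff distinct_adj_Cons)
    then show ?thesis
      using R ws d by (intro exI[of _ us1] exI[of _ i] exI[of _ p] exI[of _ q] exI[of _ r]
        exI[of _ vs1] exI[of _ ws1] exI[of _ ws2]) simp
  next
    case False
    have "us' = [] \<or> vs' = [] \<or> last (map fst us') \<noteq> hd (map fst vs')"
      using False by (cases us' rule: rev_cases; cases vs') auto
    then have "red (us' @ vs')"
      using red' by (auto simp: reduced_def distinct_adj_append_iff)
    moreover have "\<rho> (flat (us' @ vs')) = \<rho> (flat ws)"
      using eq' by simp
    ultimately have "val (us' @ vs') = val ws"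
      using red(3) free by blast
    then have "val ws = val us' @ val vs'" by simp
    then obtain ws1 ws2 where ws: "ws = ws1 @ ws2" "val us' = val ws1" "val vs' = val ws2"
      by (auto simp: map_eq_append_conv)
    have "red ws1" "red ws2"
      using red(3) unfolding ws(1) by (auto simp: reduced_def distinct_adj_append_iff)
    \<comment> \<open>No blocks meet, so the centre is the equation between empty words; the factor
      \<open>False\<close> is an arbitrary choice.\<close>
    then show ?thesis
      using red' ws R_Nil[of False] by (intro exI[of _ us'] exI[of _ False] exI[of _ "[]"] exI[of _ "[]"]
        exI[of _ "[]"] exI[of _ vs'] exI[of _ ws1] exI[of _ ws2]) simp
  qed
  then obtain us1 i p q r vs1 ws1 ws2 where red1: "red us1" "red vs1" "red ws1" "red ws2"
    and R: "p \<in> R i" "q \<in> R i" "r \<in> R i" "\<pi> i (p @ q) = \<pi> i r"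
    and val: "val us1 = val ws1" "val vs1 = val ws2"
    and flat: "flat us' = flat us1 @ p" "flat vs' = q @ flat vs1" "flat ws = flat ws1 @ r @ flat ws2"
    by blast
  let ?l = "Nonterm One # sprout One (flat us1)" and ?r = "sprout OneRev (rev (flat ws1))"
  \<comment> \<open>Contraction proceeds outwards: pairs from \<open>vs1\<close> and
    \<open>ws2\<close> into \<open>Match\<close>, then the centre into \<open>Prod\<close>, then
    pairs from \<open>us1\<close> and \<open>ws1\<close> into \<open>Prod\<close>.\<close>
  have "gen prods ((?l @ sprout One p @ Nonterm Cancel # sprout One q) @ sprout One (flat vs1) @
      Nonterm Match # sprout OneRev (rev (flat ws2)) @ sprout OneRev (rev r) @ ?r) x"
    using g' unfolding flat by simp
  then have "gen prods ((?l @ sprout One p @ Nonterm Cancel # sprout One q) @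
      Nonterm Match # sprout OneRev (rev r) @ ?r) x"
    by (rule fold_pairs[rotated, OF red1(2,4) val(2)]) (rule prods_Match)
  then have "gen prods ([Nonterm One] @ sprout One (flat us1) @ Nonterm Prod # ?r @ []) x"
    using gen_fold[OF prods_center[OF R], of ?l ?r] by simp
  then have "gen prods ([Nonterm One] @ Nonterm Prod # []) x"
    by (rule fold_pairs[rotated, OF red1(1,3) val(1)]) (rule prods_Prod)
  then show ?thesis
    using gen_single[OF prods_Start] by simp
qed

section \<open>The joint combing\<close>

abbreviation "K \<equiv> kleene_star (R False \<union> R True)"

lemma UN_R: "(\<Union>i. R i) = R False \<union> R True"
  by (auto simp: UNIV_bool)

lemma K_lists: "u \<in> K \<Longrightarrow> u \<in> lists BB"
  unfolding kleene_star_def using R_lists[of _ False] R_lists[of _ True] by fastforce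

lemma gen_One_K:
  assumes "u \<in> K"
  obtains us where "red us" "\<rho> (flat us) = \<rho> u"
    "gen prods (Nonterm One # sprout One (flat us)) (map Letter u)"
proof -
  from assms obtain rs where rs: "rs \<in> lists (\<Union>i. R i)" "u = concat rs"
    unfolding kleene_star_def UN_R by blast
  have "\<exists>us. red us \<and> gen prods (Nonterm One # sprout One (flat us)) (map Letter (concat rs))"
    by (rule gen_reduced[OF prods_empty(1) _ _ rs(1)]) (auto intro: prods_One R_append)
  then obtain us where us: "red us" "gen prods (Nonterm One # sprout One (flat us)) (map Letter u)"
    unfolding rs(2) by blast
  note flat = red_flat[OF us(1)]
  \<comment> \<open>The value is not tracked during the reduction; it is recovered by applying
    soundness to the sentential form.\<close>
  from gen_meaning[OF us(2)] obtain e y where e: "map Letter u = map Letter e @ y" "e \<in> lists BB"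
      "\<rho> e = \<one>\<^bsub>M\<^esub>" "y \<in> word_lang meaning (sprout One (flat us))"
    by auto
  from word_lang_sprout[OF e(4) flat] obtain u' where u': "y = map Letter u'" "u' \<in> lists BB"
      "\<rho> u' = \<rho> (flat us)" .
  have "map Letter u = map Letter (e @ u')" using e u' by simp
  then have "u = e @ u'" by (simp only: inj_map_eq_map[OF inj_Letter])
  then have "\<rho> (flat us) = \<rho> u" using e u' flat by (simp add: \<rho>_append \<rho>_closed)
  with us that show thesis by blast
qed

text \<open>The reduction is carried out on the reversed blocks, with the reversed combings as
  \<open>K\<close>, and the resulting sequence is turned back.\<close>

lemma gen_OneRev_K:
  assumes "w \<in> K"
  obtains ws where "red ws" "\<rho> (flat ws) = \<rho> w"
    "gen prods (Nonterm OneRev # sprout OneRev (rev (flat ws))) (map Letter (rev w))"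
proof -
  from assms obtain rs where rs: "rs \<in> lists (\<Union>i. R i)" "w = concat rs"
    unfolding kleene_star_def UN_R by blast
  let ?rs = "rev (map rev rs)"
  have "?rs \<in> lists (\<Union>i. rev ` R i)" using rs(1) by fastforce
  then have "\<exists>us. reduced (\<lambda>i. rev ` R i) (\<lambda>i p. \<pi> i (rev p) = \<one>\<^bsub>N i\<^esub>) us \<and>
      gen prods (Nonterm OneRev # sprout OneRev (flat us)) (map Letter (concat ?rs))"
    by (rule gen_reduced[OF prods_empty(2), rotated 2])
       (auto intro: prods_OneRev simp: R_append simp flip: rev_append)
  then obtain us where us: "reduced (\<lambda>i. rev ` R i) (\<lambda>i p. \<pi> i (rev p) = \<one>\<^bsub>N i\<^esub>) us"
    and "gen prods (Nonterm OneRev # sprout OneRev (flat us)) (map Letter (concat ?rs))"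
    by blast
  moreover define ws where "ws = rev (map (\<lambda>(i, p). (i, rev p)) us)"
  have "flat us = rev (flat ws)"
    unfolding ws_def by (induction us) auto
  moreover have "concat ?rs = rev w"
    unfolding rs(2) by (simp add: rev_concat rev_map)
  ultimately have g: "gen prods (Nonterm OneRev # sprout OneRev (rev (flat ws))) (map Letter (rev w))"
    by simp
  have "map fst ws = rev (map fst us)"
    unfolding ws_def by (induction us) auto
  then have red: "red ws"
    using us unfolding reduced_def by (auto simp: ws_def)
  note flat = red_flat[OF red]
  from gen_meaning[OF g] obtain e y where e: "map Letter (rev w) = map Letter (rev e) @ y"
      "e \<in> lists BB" "\<rho> e = \<one>\<^bsub>M\<^esub>" "y \<in> word_lang meaning (sprout OneRev (rev (flat ws)))"
    by auto
  from word_lang_sprout_rev[OF e(4) flat] obtain w' where w': "y = map Letter (rev w')"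
      "w' \<in> lists BB" "\<rho> w' = \<rho> (flat ws)" .
  have "map Letter (rev w) = map Letter (rev (w' @ e))" using e w' by simp
  then have "rev w = rev (w' @ e)" by (simp only: inj_map_eq_map[OF inj_Letter])
  then have "w = w' @ e" by (simp only: rev_is_rev_conv)
  then have "\<rho> (flat ws) = \<rho> w" using e w' flat by (simp add: \<rho>_append \<rho>_closed)
  with red g that show thesis by blast
qed

lemma gen_Start_K:
  assumes "u \<in> K" "v \<in> K" "w \<in> K" "\<rho> u \<otimes>\<^bsub>M\<^esub> \<rho> v = \<rho> w"
  shows "gen prods [Nonterm Start] (map Letter u @ [Hash1] @ map Letter v @ [Hash2] @ map Letter (rev w))"
proof -
  obtain us where us: "red us" "\<rho> (flat us) = \<rho> u"
      "gen prods (Nonterm One # sprout One (flat us)) (map Letter u)"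
    using gen_One_K[OF assms(1)] .
  obtain vs where vs: "red vs" "\<rho> (flat vs) = \<rho> v"
      "gen prods (Nonterm One # sprout One (flat vs)) (map Letter v)"
    using gen_One_K[OF assms(2)] .
  obtain ws where ws: "red ws" "\<rho> (flat ws) = \<rho> w"
      "gen prods (Nonterm OneRev # sprout OneRev (rev (flat ws))) (map Letter (rev w))"
    using gen_OneRev_K[OF assms(3)] .
  \<comment> \<open>The leading slots of the second and third word are those that the separator
    rules of \<open>Cancel\<close> and \<open>Match\<close> provide.\<close>
  have "gen prods ((Nonterm One # sprout One (flat us)) @ [Term Hash1] @
      (Nonterm One # sprout One (flat vs)) @ [Term Hash2] @ Nonterm OneRev # sprout OneRev (rev (flat ws)))
      (map Letter u @ [Hash1] @ map Letter v @ [Hash2] @ map Letter (rev w))"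
    by (intro gen_append us vs ws gen.intros)
  then have "gen prods ((Nonterm One # sprout One (flat us)) @ Nonterm Cancel #
      sprout One (flat vs) @ [Term Hash2] @ Nonterm OneRev # sprout OneRev (rev (flat ws)))
      (map Letter u @ [Hash1] @ map Letter v @ [Hash2] @ map Letter (rev w))"
    by (intro gen_fold[OF prods_hash(1)]) simp
  then have "gen prods ((Nonterm One # sprout One (flat us) @ Nonterm Cancel #
      sprout One (flat vs)) @ Nonterm Match # sprout OneRev (rev (flat ws)))
      (map Letter u @ [Hash1] @ map Letter v @ [Hash2] @ map Letter (rev w))"
    by (intro gen_fold[OF prods_hash(2)]) simp
  then show ?thesis
    using us(1,2) vs(1,2) ws(1,2) assms(4)
    by (intro gen_Start[of us vs ws]) (simp_all add: \<rho>_append red_flat)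
qed

text \<open>By soundness the whole generated language is a table of true equations, so it can be
  restricted to \<open>K\<close> componentwise; completeness shows that no equation within
  \<open>K\<close> is missing.\<close>

lemma context_free_mult_table: "word_hyperbolic_wrt M \<rho> K"
proof -
  let ?T = "{(u, v, w). gen prods [Nonterm Start]
    (map Letter u @ [Hash1] @ map Letter v @ [Hash2] @ map Letter (rev w))} \<inter> TT"
  have "{x. gen prods [Nonterm Start] x} = table ?T"
    using gen_meaning[of "[Nonterm Start]"] by (fastforce simp: table_def)
  with context_free_prods[of Start] have "context_free_language (table ?T)" by simp
  moreover have "regular_language BB K"
    using combing star disj unfolding regular_combing_def by (intro regular_language_star_Un) auto
  ultimately have "context_free_language (table (?T \<inter> K \<times> K \<times> K))"
    by (rule context_free_table_restrict)
  also have "?T \<inter> K \<times> K \<times> K = {(u, v, w). u \<in> K \<and> v \<in> K \<and> w \<in> K \<and> (u, v, w) \<in> ?T}"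
    by blast
  also have "\<dots> = {(u, v, w). u \<in> K \<and> v \<in> K \<and> w \<in> K \<and> \<rho> u \<otimes>\<^bsub>M\<^esub> \<rho> v = \<rho> w}"
  proof -
    have "(u, v, w) \<in> ?T \<longleftrightarrow> \<rho> u \<otimes>\<^bsub>M\<^esub> \<rho> v = \<rho> w" if "u \<in> K" "v \<in> K" "w \<in> K" for u v w
      using gen_Start_K[OF that] that[THEN K_lists] \<rho>_append[OF that(1,2)[THEN K_lists]]
      by (auto)
    then show ?thesis by (simp cong: conj_cong)
  qed
  finally show ?thesis
    unfolding word_hyperbolic_wrt_def mult_table_eq .
qed

text \<open>Every single letter is equal in its factor to some word of \<open>R i\<close>, so a word
  can be replaced letter by letter.\<close>

lemma \<rho>_K: "\<rho> ` K = carrier M"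
proof
  show "\<rho> ` K \<subseteq> carrier M"
    using \<rho>_closed K_lists by blast
  have K: "\<exists>k\<in>K. \<rho> k = \<rho> u" if "u \<in> lists BB" for u
    using that
  proof (induction u)
    case Nil
    show ?case using kleene_star_Nil by blast
  next
    case (Cons c u)
    then obtain k where k: "k \<in> K" "\<rho> k = \<rho> u" by auto
    from Cons.hyps obtain i where c: "[c] \<in> lists (B i)" by auto
    then have "\<pi> i [c] \<in> \<pi> i ` R i"
      using \<pi>_closed[OF c] combing by (auto simp: regular_combing_def)
    then obtain r where r: "r \<in> R i" "\<rho> [c] = \<rho> r"
      using compat[OF c R_lists] by blast
    have "\<rho> ([c] @ u) = \<rho> (r @ k)"
      using \<rho>_append[OF B_lists[OF c] Cons(2)] \<rho>_append[OF B_lists[OF R_lists[OF r(1)]] K_lists[OF k(1)]] k r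
      by simp
    moreover have "r @ k \<in> K"
      using r(1) k(1) by (cases i) (auto intro: kleene_star_append kleene_star_incl)
    ultimately show ?case by auto
  qed
  have "carrier M = \<rho> ` lists BB"
    using gen_M unfolding generates_via_def by blast
  show "carrier M \<subseteq> \<rho> ` K"
  proof
    fix m assume "m \<in> carrier M"
    then obtain u where "u \<in> lists BB" "m = \<rho> u"
      using \<open>carrier M = \<rho> ` lists BB\<close> by blast
    with K[of u] show "m \<in> \<rho> ` K" by (metis imageI)
  qed
qed

lemma regular_combing_K: "regular_combing M BB \<rho> K"
  using combing star disj \<rho>_K unfolding regular_combing_def
  by (auto intro: regular_language_star_Un)

end


section \<open>Normal forms in free products\<close>

text \<open>Only uniqueness of normal forms is established here; the reduced sequences themselves
  are supplied by \<open>gen_reduced\<close>.\<close>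

locale normal_forms =
  fixes A :: "bool \<Rightarrow> 'x set" and \<R> :: "bool \<Rightarrow> ('x list \<times> 'x list) set"
  assumes disjoint: "A False \<inter> A True = {}"
    and relators: "\<R> i \<subseteq> lists (A i) \<times> lists (A i)"
begin

abbreviation "N i \<equiv> presented_monoid (A i) (\<R> i)"
abbreviation "cls i \<equiv> pres_class (A i) (\<R> i)"

lemma monoid_N: "monoid (N i)"
  by (rule monoid_presented_monoid)

lemma cls_closed: "u \<in> lists (A i) \<Longrightarrow> cls i u \<in> carrier (N i)"
  by (simp add: presented_monoid_def)

lemma cls_Nil: "cls i [] = \<one>\<^bsub>N i\<^esub>"
  by (simp add: presented_monoid_def)

lemma cls_append: "u \<in> lists (A i) \<Longrightarrow> v \<in> lists (A i) \<Longrightarrow> cls i (u @ v) = cls i u \<otimes>\<^bsub>N i\<^esub> cls i v"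
  by (simp add: presented_monoid_mult)

definition nf :: "(bool \<times> 'x list set) list \<Rightarrow> bool" where
  "nf s \<longleftrightarrow> distinct_adj (map fst s) \<and> (\<forall>(i, g)\<in>set s. g \<in> carrier (N i) \<and> g \<noteq> \<one>\<^bsub>N i\<^esub>)"

definition push :: "bool \<Rightarrow> 'x list set \<Rightarrow> (bool \<times> 'x list set) list \<Rightarrow> (bool \<times> 'x list set) list" where
  "push i g s = (if g = \<one>\<^bsub>N i\<^esub> then s else (i, g) # s)"

text \<open>
  Van der Waerden's trick: the factors act on the reduced sequences, and the action on the empty
  sequence recovers the normal form.
\<close>

definition act :: "bool \<Rightarrow> 'x list set \<Rightarrow> (bool \<times> 'x list set) list \<Rightarrow> (bool \<times> 'x list set) list" where
  "act i g s = (if s \<noteq> [] \<and> fst (hd s) = i then push i (g \<otimes>\<^bsub>N i\<^esub> snd (hd s)) (tl s) else push i g s)"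

lemma nf_Cons: "nf ((i, g) # s) \<longleftrightarrow>
    nf s \<and> g \<in> carrier (N i) \<and> g \<noteq> \<one>\<^bsub>N i\<^esub> \<and> (s = [] \<or> fst (hd s) \<noteq> i)"
  by (auto simp: nf_def distinct_adj_Cons hd_map)

lemma act_Cons: "act i g ((i, h) # s) = push i (g \<otimes>\<^bsub>N i\<^esub> h) s"
  by (simp add: act_def)

lemma act_push: "s = [] \<or> fst (hd s) \<noteq> i \<Longrightarrow> act i g s = push i g s"
  by (auto simp: act_def)

lemma push_one: "push i \<one>\<^bsub>N i\<^esub> s = s"
  and push_neq: "g \<noteq> \<one>\<^bsub>N i\<^esub> \<Longrightarrow> push i g s = (i, g) # s"
  by (simp_all add: push_def)

lemma nf_cases:
  assumes "nf s"
  obtains h s' where "s = (i, h) # s'" "nf s'" "h \<in> carrier (N i)" "h \<noteq> \<one>\<^bsub>N i\<^esub>" "s' = [] \<or> fst (hd s') \<noteq> i"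
  | "s = [] \<or> fst (hd s) \<noteq> i"
proof (cases "s = [] \<or> fst (hd s) \<noteq> i")
  case False
  then obtain h s' where "s = (i, h) # s'" by (cases s) auto
  with assms show ?thesis by (intro that(1)[of h s']) (auto simp: nf_Cons)
qed (rule that(2))

lemma nf_act:
  assumes "nf s" "g \<in> carrier (N i)"
  shows "nf (act i g s)"
  using assms(1)
proof (cases s rule: nf_cases[where i = i])
  case (1 h s')
  then show ?thesis
    using assms(2) monoid.m_closed[OF monoid_N] by (auto simp: act_Cons push_def nf_Cons)
next
  case 2
  then show ?thesis using assms by (auto simp: act_push push_def nf_Cons)
qed

lemma act_one: "nf s \<Longrightarrow> act i \<one>\<^bsub>N i\<^esub> s = s"
  by (erule nf_cases[where i = i]) (auto simp: act_Cons act_push push_def monoid.l_one[OF monoid_N])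

text \<open>The delicate case is a leading block \<open>k\<close> with \<open>h\<close> times
  \<open>k\<close> equal to one: the block vanishes and \<open>g\<close> is pushed afresh, in
  agreement with the associative law in the factor.\<close>

lemma act_mult:
  assumes "nf s" "g \<in> carrier (N i)" "h \<in> carrier (N i)"
  shows "act i (g \<otimes>\<^bsub>N i\<^esub> h) s = act i g (act i h s)"
  using assms(1)
proof (cases s rule: nf_cases[where i = i])
  case (1 k s')
  have "(g \<otimes>\<^bsub>N i\<^esub> h) \<otimes>\<^bsub>N i\<^esub> k = g \<otimes>\<^bsub>N i\<^esub> (h \<otimes>\<^bsub>N i\<^esub> k)"
    using assms 1 by (intro monoid.m_assoc[OF monoid_N])
  then show ?thesis
    using 1(5) assms(2) unfolding 1(1) act_Cons
    by (cases "h \<otimes>\<^bsub>N i\<^esub> k = \<one>\<^bsub>N i\<^esub>")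
       (simp_all add: push_one push_neq act_Cons act_push[OF 1(5)] monoid.r_one[OF monoid_N])
next
  case 2
  then show ?thesis
    using assms(2)
    by (cases "h = \<one>\<^bsub>N i\<^esub>")
       (simp_all add: act_push push_one push_neq act_Cons monoid.r_one[OF monoid_N])
qed

definition side :: "'x \<Rightarrow> bool" where
  "side a \<longleftrightarrow> a \<in> A True"

lemma side: "a \<in> A i \<Longrightarrow> side a = i"
  using disjoint by (cases i) (auto simp: side_def)

definition act_word :: "'x list \<Rightarrow> (bool \<times> 'x list set) list \<Rightarrow> (bool \<times> 'x list set) list" where
  "act_word u s = foldr (\<lambda>a. act (side a) (cls (side a) [a])) u s"

lemma act_word_append: "act_word (u @ v) s = act_word u (act_word v s)"
  by (simp add: act_word_def)

lemma act_word_eq_act: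
  assumes "nf s"
  shows "u \<in> lists (A i) \<Longrightarrow> act_word u s = act i (cls i u) s"
proof (induction u)
  case Nil
  show ?case using act_one[OF assms] by (simp add: act_word_def cls_Nil)
next
  case (Cons a u)
  have "side a = i" using Cons.prems by (simp add: side)
  with Cons have "act_word (a # u) s = act i (cls i [a]) (act i (cls i u) s)"
    by (simp add: act_word_def)
  also have "\<dots> = act i (cls i [a] \<otimes>\<^bsub>N i\<^esub> cls i u) s"
    using Cons by (intro act_mult[symmetric] assms cls_closed) auto
  also have "cls i [a] \<otimes>\<^bsub>N i\<^esub> cls i u = cls i (a # u)"
    using Cons cls_append[of "[a]" i u] by simp
  finally show ?case .
qed

lemma nf_act_word: "u \<in> lists (A False \<union> A True) \<Longrightarrow> nf s \<Longrightarrow> nf (act_word u s)"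
proof (induction u)
  case (Cons a u)
  then have "a \<in> A (side a)" using side by auto
  with Cons show ?case by (auto simp: act_word_def intro!: nf_act cls_closed)
qed (simp add: act_word_def)

abbreviation "cong_prod \<equiv> pres_cong (A False \<union> A True) (\<R> False \<union> \<R> True)"

text \<open>A relator lies in a single factor, where the action depends only on the class of the
  word. Membership in the alphabet is carried along because the product case must know that the
  intermediate sequence is a normal form.\<close>

lemma act_word_cong:
  "cong_prod u v \<Longrightarrow> u \<in> lists (A False \<union> A True) \<and> v \<in> lists (A False \<union> A True) \<and>
    (\<forall>s. nf s \<longrightarrow> act_word u s = act_word v s)"
proof (induction rule: pres_cong.induct)
  case (rel u v)
  then obtain i where i: "(u, v) \<in> \<R> i" by blast
  then have uv: "u \<in> lists (A i)" "v \<in> lists (A i)" using relators[of i] by auto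
  moreover have "cls i u = cls i v"
    using pres_class_eq_iff[OF uv(2)] pres_cong.rel[OF i] by blast
  ultimately show ?case
    by (cases i) (auto simp: act_word_eq_act)
next
  case (mult u v u' v')
  then show ?case by (auto simp: act_word_append nf_act_word)
qed auto

lemma cong_prod_factor: "pres_cong (A i) (\<R> i) u v \<Longrightarrow> cong_prod u v"
proof (induction rule: pres_cong.induct)
  case (rel u v)
  then show ?case by (cases i) (auto intro: pres_cong.rel)
next
  case (refl u)
  then show ?case by (cases i) (auto intro!: pres_cong.refl)
qed (blast intro: pres_cong.sym pres_cong.trans pres_cong.mult)+

text \<open>Acting from the right end, each block meets a sequence starting in the other factor, so
  it is simply put in front.\<close>

lemma act_word_reduced:
  "reduced (\<lambda>i. lists (A i)) (\<lambda>i u. cls i u = \<one>\<^bsub>N i\<^esub>) bs \<Longrightarrow>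
    nf (map (\<lambda>(i, u). (i, cls i u)) bs) \<and> act_word (flat bs) [] = map (\<lambda>(i, u). (i, cls i u)) bs"
proof (induction bs)
  case Nil
  show ?case by (simp add: nf_def act_word_def)
next
  case (Cons b bs)
  obtain i u where b: "b = (i, u)" by fastforce
  let ?s = "map (\<lambda>(i, u). (i, cls i u)) bs"
  have u: "u \<in> lists (A i)" "cls i u \<noteq> \<one>\<^bsub>N i\<^esub>" "bs = [] \<or> fst (hd bs) \<noteq> i"
    and "reduced (\<lambda>i. lists (A i)) (\<lambda>i u. cls i u = \<one>\<^bsub>N i\<^esub>) bs"
    using Cons.prems b by (auto simp: reduced_def distinct_adj_Cons hd_map)
  with Cons.IH have IH: "nf ?s" "act_word (flat bs) [] = ?s" by auto
  have hd: "?s = [] \<or> fst (hd ?s) \<noteq> i"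
    using u(3) by (cases bs) auto
  have "act_word (flat (b # bs)) [] = act i (cls i u) ?s"
    using IH u(1) b by (simp add: act_word_append act_word_eq_act)
  also have "\<dots> = (i, cls i u) # ?s"
    using act_push[OF hd] u(2) by (simp add: push_def)
  finally show ?case
    using IH(1) u cls_closed[OF u(1)] hd b by (simp add: nf_Cons)
qed

lemma reduced_unique:
  assumes "reduced (\<lambda>i. lists (A i)) (\<lambda>i u. cls i u = \<one>\<^bsub>N i\<^esub>) bs"
    and "reduced (\<lambda>i. lists (A i)) (\<lambda>i u. cls i u = \<one>\<^bsub>N i\<^esub>) bs'"
    and "cong_prod (flat bs) (flat bs')"
  shows "map (\<lambda>(i, u). (i, cls i u)) bs = map (\<lambda>(i, u). (i, cls i u)) bs'"
proof -
  have "nf []" by (simp add: nf_def)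
  then show ?thesis
    using act_word_cong[OF assms(3)] assms(1,2)[THEN act_word_reduced] by simp
qed

end


section \<open>Free products of word-hyperbolic monoids\<close>

text \<open>Alphabet and combing are kept; the table is literally the same because \<open>h\<close>
  is injective.\<close>

lemma star_word_hyperbolic_iso:
  assumes M: "monoid M" and N: "monoid N" and h: "h \<in> iso M N" and star: "star_word_hyperbolic M"
  shows "star_word_hyperbolic N"
proof -
  interpret M: monoid M by (rule M)
  interpret N: monoid N by (rule N)
  from star obtain A :: "nat set" and \<pi> R where
    gen: "generates_via M A \<pi>" and comb: "regular_combing M A \<pi> R"
    and hyp: "word_hyperbolic_wrt M \<pi> R" and R: "kleene_star R = R"
    unfolding star_word_hyperbolic_def by blast
  have mult: "h (x \<otimes>\<^bsub>M\<^esub> y) = h x \<otimes>\<^bsub>N\<^esub> h y" if "x \<in> carrier M" "y \<in> carrier M" for x y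
    using h that by (auto simp: iso_def hom_def)
  have bij: "bij_betw h (carrier M) (carrier N)" using h by (simp add: iso_def)
  have surj: "h ` carrier M = carrier N" using bij by (simp add: bij_betw_def)
  have h1: "h \<one>\<^bsub>M\<^esub> \<in> carrier N" using surj by blast
  \<comment> \<open>Homomorphisms here need not preserve the unit; surjectivity forces it, via a
    preimage of the unit of \<open>N\<close>.\<close>
  have "h \<one>\<^bsub>M\<^esub> = \<one>\<^bsub>N\<^esub>"
  proof -
    obtain x where x: "x \<in> carrier M" "h x = \<one>\<^bsub>N\<^esub>" using surj N.one_closed by (metis imageE)
    then have "h \<one>\<^bsub>M\<^esub> = h \<one>\<^bsub>M\<^esub> \<otimes>\<^bsub>N\<^esub> h x" using h1 by simp
    also have "\<dots> = h x" using mult[OF M.one_closed x(1)] x(1) by simp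
    finally show ?thesis using x(2) by simp
  qed
  moreover have \<pi>: "\<pi> ` lists A = carrier M" "\<pi> \<in> hom (free_monoid A) M" "\<pi> [] = \<one>\<^bsub>M\<^esub>" "finite A"
    using gen by (auto simp: generates_via_def)
  moreover have "(h \<circ> \<pi>) \<in> hom (free_monoid A) N"
    using \<pi>(2) h by (auto simp: iso_def intro: hom_compose)
  moreover have "(h \<circ> \<pi>) ` lists A = carrier N"
    by (simp only: image_comp[symmetric] \<pi>(1) surj)
  ultimately have "generates_via N A (h \<circ> \<pi>)"
    unfolding generates_via_def by simp
  moreover have "regular_combing N A (h \<circ> \<pi>) R"
    using comb surj unfolding regular_combing_def by (simp only: image_comp[symmetric])
  moreover have "mult_table N (h \<circ> \<pi>) R = mult_table M \<pi> R"
  proof -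
    have R_car: "\<pi> u \<in> carrier M" if "u \<in> R" for u
      using comb that unfolding regular_combing_def by blast
    have "(h (\<pi> u) \<otimes>\<^bsub>N\<^esub> h (\<pi> v) = h (\<pi> w)) = (\<pi> u \<otimes>\<^bsub>M\<^esub> \<pi> v = \<pi> w)"
      if "u \<in> R" "v \<in> R" "w \<in> R" for u v w
      using bij_betw_imp_inj_on[OF bij] R_car[OF that(1)] R_car[OF that(2)] R_car[OF that(3)]
      by (simp add: inj_on_eq_iff flip: mult)
    then show ?thesis unfolding mult_table_eq by (simp cong: conj_cong)
  qed
  ultimately show ?thesis
    using hyp R unfolding star_word_hyperbolic_def word_hyperbolic_wrt_def by metis
qed

lemma inverse_iso:
  assumes "monoid M" "h \<in> iso M N"
  shows "inv_into (carrier M) h \<in> iso N M"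
proof -
  interpret monoid M by fact
  have bij: "bij_betw h (carrier M) (carrier N)" and hom: "h \<in> hom M N"
    using assms(2) by (auto simp: iso_def)
  let ?k = "inv_into (carrier M) h"
  have bij': "bij_betw ?k (carrier N) (carrier M)" by (rule bij_betw_inv_into[OF bij])
  have "?k (x \<otimes>\<^bsub>N\<^esub> y) = ?k x \<otimes>\<^bsub>M\<^esub> ?k y" if "x \<in> carrier N" "y \<in> carrier N" for x y
  proof -
    have k: "?k x \<in> carrier M" "?k y \<in> carrier M"
      using bij' that by (auto simp: bij_betw_def)
    have "h (?k x \<otimes>\<^bsub>M\<^esub> ?k y) = x \<otimes>\<^bsub>N\<^esub> y"
      using hom k that bij by (simp add: hom_def bij_betw_inv_into_right)
    then show ?thesis
      using inv_into_f_f[OF bij_betw_imp_inj_on[OF bij] m_closed[OF k]] by simp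
  qed
  then show ?thesis
    using bij' by (auto simp: iso_def hom_def bij_betw_def)
qed

text \<open>Serves to make the alphabets of the two combings disjoint. The table is carried over by
  a letter-to-letter substitution.\<close>

lemma star_word_hyperbolic_relabel:
  fixes f :: "nat \<Rightarrow> nat"
  assumes f: "inj f" and star: "star_word_hyperbolic M"
  obtains A \<pi> R where "A \<subseteq> range f" "generates_via M A \<pi>" "regular_combing M A \<pi> R"
    "word_hyperbolic_wrt M \<pi> R" "kleene_star R = R"
proof -
  from star obtain A :: "nat set" and \<pi> R where
    gen: "generates_via M A \<pi>" and comb: "regular_combing M A \<pi> R"
    and hyp: "word_hyperbolic_wrt M \<pi> R" and R: "kleene_star R = R"
    unfolding star_word_hyperbolic_def by blast
  define g where "g = inv_into UNIV f"
  have g [simp]: "g (f x) = x" for x using f by (simp add: g_def)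
  then have gf [simp]: "g \<circ> f = (\<lambda>x. x)" by auto
  have mg [simp]: "map g (map f u) = u" for u by simp
  let ?\<pi> = "\<pi> \<circ> map g" and ?R = "map f ` R"
  have lists: "lists (f ` A) = map f ` lists A" by (rule lists_image)
  have im: "?\<pi> ` (map f ` X) = \<pi> ` X" for X
    by (simp add: image_image)
  have "?\<pi> \<in> hom (free_monoid (f ` A)) M"
    using gen unfolding generates_via_def hom_def free_monoid_def
    by (auto simp: lists)
  moreover have "?\<pi> ` lists (f ` A) = carrier M"
    using gen unfolding generates_via_def by (simp only: lists im)
  ultimately have "generates_via M (f ` A) ?\<pi>"
    using gen by (simp only: generates_via_def comp_apply list.map finite_imageI)
  moreover have "regular_combing M (f ` A) ?\<pi> ?R"
  proof -
    from comb obtain Q \<delta> q0 F where D: "finite A" "finite Q" "q0 \<in> Q" "F \<subseteq> Q"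
        "\<forall>q\<in>Q. \<forall>a\<in>A. \<delta> q a \<in> Q" "R = {w \<in> lists A. foldl \<delta> (q0 :: nat) w \<in> F}"
      unfolding regular_combing_def regular_language_def by blast
    have run: "foldl (\<lambda>q a. \<delta> q (g a)) q (map f w) = foldl \<delta> q w" for q w
      by (induction w arbitrary: q) auto
    have "?R = {w \<in> lists (f ` A). foldl (\<lambda>q a. \<delta> q (g a)) q0 w \<in> F}"
      unfolding lists D(6) by (auto simp: run)
    then have "regular_language (f ` A) ?R"
      using D by (intro regular_languageI[of _ Q q0 F "\<lambda>q a. \<delta> q (g a)"]) auto
    then show ?thesis
      using comb unfolding regular_combing_def by (simp only: im)
  qed
  moreover have "word_hyperbolic_wrt M ?\<pi> ?R"
  proof -
    let ?T = "{(u, v, w). u \<in> R \<and> v \<in> R \<and> w \<in> R \<and> \<pi> u \<otimes>\<^bsub>M\<^esub> \<pi> v = \<pi> w}"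
    let ?f = "\<lambda>c. [Letter (f c)]"
    have R_A: "u \<in> lists A" if "u \<in> R" for u
      using comb regular_language_lists that unfolding regular_combing_def by blast
    have eq: "concat (map ?f u) = map Letter (map f u)" for u
      by (induction u) auto
    have "finite A" using gen by (simp add: generates_via_def)
    with hyp have "context_free_language {concat (map ?f u) @ [Hash1] @ concat (map ?f v) @ [Hash2] @
        concat (map ?f (rev w)) | u v w. (u, v, w) \<in> ?T \<and> u \<in> lists A \<and> v \<in> lists A \<and> w \<in> lists A}"
      unfolding word_hyperbolic_wrt_def mult_table_eq by (intro context_free_table_subst)
    also have "{concat (map ?f u) @ [Hash1] @ concat (map ?f v) @ [Hash2] @
        concat (map ?f (rev w)) | u v w. (u, v, w) \<in> ?T \<and> u \<in> lists A \<and> v \<in> lists A \<and> w \<in> lists A}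
        = {map Letter (map f u) @ [Hash1] @ map Letter (map f v) @ [Hash2] @ map Letter (rev (map f w)) |
          u v w. (u, v, w) \<in> ?T}"
      unfolding eq rev_map using R_A by blast
    also have "\<dots> = mult_table M ?\<pi> ?R"
    proof (intro equalityI subsetI)
      fix x assume "x \<in> {map Letter (map f u) @ [Hash1] @ map Letter (map f v) @ [Hash2] @
          map Letter (rev (map f w)) | u v w. (u, v, w) \<in> ?T}"
      then obtain u v w where "(u, v, w) \<in> ?T"
          "x = map Letter (map f u) @ [Hash1] @ map Letter (map f v) @ [Hash2] @ map Letter (rev (map f w))"
        by blast
      then show "x \<in> mult_table M ?\<pi> ?R"
        unfolding mult_table_def
        by (intro CollectI exI[of _ "map f u"] exI[of _ "map f v"] exI[of _ "map f w"]) simp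
    next
      fix x assume "x \<in> mult_table M ?\<pi> ?R"
      then obtain u v w where "u \<in> R" "v \<in> R" "w \<in> R"
          "?\<pi> (map f u) \<otimes>\<^bsub>M\<^esub> ?\<pi> (map f v) = ?\<pi> (map f w)"
          "x = map Letter (map f u) @ [Hash1] @ map Letter (map f v) @ [Hash2] @ map Letter (rev (map f w))"
        unfolding mult_table_def by blast
      then show "x \<in> {map Letter (map f u) @ [Hash1] @ map Letter (map f v) @ [Hash2] @
          map Letter (rev (map f w)) | u v w. (u, v, w) \<in> ?T}"
        by (intro CollectI exI[of _ u] exI[of _ v] exI[of _ w]) simp
    qed
    finally show ?thesis unfolding word_hyperbolic_wrt_def .
  qed
  moreover have "kleene_star ?R = ?R"
    unfolding kleene_star_def lists_image image_image
    using R by (simp add: kleene_star_def map_concat[symmetric] flip: image_image[of "map f" concat])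
  ultimately show thesis
    by (rule that[rotated]) auto
qed

lemma free_factors_star_word_hyperbolic:
  fixes B :: "bool \<Rightarrow> nat set"
  assumes "free_factors N B \<pi> R M \<rho>"
  shows "star_word_hyperbolic M"
proof -
  interpret free_factors N B \<pi> R M \<rho> by fact
  show ?thesis
    unfolding star_word_hyperbolic_def
    using gen_M regular_combing_K context_free_mult_table kleene_star_idem by blast
qed

context normal_forms begin

abbreviation "P \<equiv> presented_monoid (A False \<union> A True) (\<R> False \<union> \<R> True)"

theorem star_word_hyperbolic_free_product:
  assumes star: "\<And>i. star_word_hyperbolic (N i)"
  shows "star_word_hyperbolic P"
proof -
  \<comment> \<open>Even numbers for one factor, odd numbers for the other.\<close>
  define f :: "bool \<Rightarrow> nat \<Rightarrow> nat" where "f i n = 2 * n + of_bool i" for i n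
  have f: "inj (f i)" "range (f False) \<inter> range (f True) = {}" for i
    by (auto simp: f_def inj_def) presburger
  have "\<forall>i. \<exists>D. fst D \<subseteq> range (f i) \<and> generates_via (N i) (fst D) (fst (snd D)) \<and>
      regular_combing (N i) (fst D) (fst (snd D)) (snd (snd D)) \<and>
      word_hyperbolic_wrt (N i) (fst (snd D)) (snd (snd D)) \<and> kleene_star (snd (snd D)) = snd (snd D)"
    using star_word_hyperbolic_relabel[OF f(1) star] by (metis fst_conv snd_conv)
  from choice[OF this] obtain D where D: "\<And>i. fst (D i) \<subseteq> range (f i) \<and>
      generates_via (N i) (fst (D i)) (fst (snd (D i))) \<and>
      regular_combing (N i) (fst (D i)) (fst (snd (D i))) (snd (snd (D i))) \<and>
      word_hyperbolic_wrt (N i) (fst (snd (D i))) (snd (snd (D i))) \<and>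
      kleene_star (snd (snd (D i))) = snd (snd (D i))"
    by blast
  define B \<pi> R where "B i = fst (D i)" and "\<pi> i = fst (snd (D i))" and "R i = snd (snd (D i))" for i
  have B: "B i \<subseteq> range (f i)" and gen: "generates_via (N i) (B i) (\<pi> i)"
    and comb: "regular_combing (N i) (B i) (\<pi> i) (R i)"
    and hyp: "word_hyperbolic_wrt (N i) (\<pi> i) (R i)" and R: "kleene_star (R i) = R i" for i
    using D unfolding B_def \<pi>_def R_def by blast+
  have disj: "B False \<inter> B True = {}" using B[of False] B[of True] f(2) by blast
  let ?A = "A False \<union> A True" and ?B = "B False \<union> B True"
  let ?cls = "pres_class ?A (\<R> False \<union> \<R> True)"

  \<comment> \<open>Letters of the combing are translated into words over the presentation
    generators, as the two alphabets are unrelated.\<close>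
  have "\<exists>t. c \<in> B i \<longrightarrow> t \<in> lists (A i) \<and> \<pi> i [c] = cls i t" for c i
  proof (cases "c \<in> B i")
    case True
    then have "\<pi> i [c] \<in> \<pi> i ` lists (B i)" by simp
    also have "\<dots> = cls i ` lists (A i)"
      using gen[of i] by (simp add: generates_via_def presented_monoid_def)
    finally show ?thesis by blast
  qed simp
  then have "\<forall>c i. \<exists>t. c \<in> B i \<longrightarrow> t \<in> lists (A i) \<and> \<pi> i [c] = cls i t" by blast
  then obtain t where "\<forall>c i. c \<in> B i \<longrightarrow> t c i \<in> lists (A i) \<and> \<pi> i [c] = cls i (t c i)"
    by (simp only: choice_iff) blast
  then have t: "c \<in> B i \<Longrightarrow> t c i \<in> lists (A i) \<and> \<pi> i [c] = cls i (t c i)" for c i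
    by blast
  \<comment> \<open>The truth value of \<open>c \<in> B True\<close> is the index of the factor to
    which \<open>c\<close> belongs.\<close>
  define \<tau> where "\<tau> u = concat (map (\<lambda>c. t c (c \<in> B True)) u)" for u
  have \<tau>_Cons: "\<tau> (c # u) = t c i @ \<tau> u" if "c \<in> B i" for c u i
  proof -
    have "(c \<in> B True) = i" using that disj by (cases i) auto
    then show ?thesis by (simp add: \<tau>_def)
  qed
  have \<tau>_append: "\<tau> (u @ v) = \<tau> u @ \<tau> v" for u v
    by (simp add: \<tau>_def)
  have \<tau>_A: "\<tau> u \<in> lists (A i)" if "u \<in> lists (B i)" for u i
    using that by (induction u) (auto simp: \<tau>_def[of "[]"] \<tau>_Cons t)
  have \<tau>_lists: "\<tau> u \<in> lists ?A" if "u \<in> lists ?B" for u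
    using that
  proof (induction u)
    case (Cons c u)
    from Cons.hyps(1) obtain i where c: "c \<in> B i" by blast
    have "t c i \<in> lists ?A" using t[OF c] by (cases i) auto
    with Cons c show ?case by (simp add: \<tau>_Cons[OF c])
  qed (simp add: \<tau>_def)
  have \<pi>: "\<pi> i u = cls i (\<tau> u)" if "u \<in> lists (B i)" for u i
    using that
  proof (induction u)
    case Nil
    show ?case using gen[of i] by (simp add: generates_via_def \<tau>_def cls_Nil)
  next
    case (Cons c u)
    have "\<pi> i ([c] @ u) = \<pi> i [c] \<otimes>\<^bsub>N i\<^esub> \<pi> i u"
      using gen[of i] Cons.hyps unfolding generates_via_def hom_def free_monoid_def
      by (simp del: append_Cons append_Nil)
    also have "\<dots> = cls i (t c i @ \<tau> u)"
      using t[OF Cons.hyps(1)] \<tau>_A[OF Cons.hyps(2)] Cons.IH by (simp add: cls_append)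
    finally show ?case using Cons.hyps by (simp add: \<tau>_Cons)
  qed
  have cls_eq: "?cls x = ?cls y \<longleftrightarrow> cong_prod x y" if "y \<in> lists ?A" for x y
    using pres_class_eq_iff[OF that] .
  have factor: "?cls x = ?cls y" if "cls i x = cls i y" "y \<in> lists (A i)" for x y i
  proof -
    have "y \<in> lists ?A" using that(2) by (cases i) auto
    moreover have "cong_prod x y"
      using that pres_class_eq_iff[OF that(2)] by (blast intro: cong_prod_factor)
    ultimately show ?thesis by (simp only: cls_eq)
  qed

  let ?\<rho> = "\<lambda>u. ?cls (\<tau> u)"
  \<comment> \<open>Conversely, each presentation generator is represented by a word over the
    combing alphabet of its own factor.\<close>
  have surj: "\<exists>u\<in>lists ?B. ?cls x = ?\<rho> u" if "x \<in> lists ?A" for x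
    using that
  proof (induction x)
    case Nil
    show ?case by (rule bexI[of _ "[]"]) (auto simp: \<tau>_def)
  next
    case (Cons a x)
    then obtain u where u: "u \<in> lists ?B" "?cls x = ?\<rho> u" by blast
    from Cons.hyps(1) obtain i where a: "a \<in> A i" by blast
    then have "cls i [a] \<in> \<pi> i ` lists (B i)"
      using gen[of i] cls_closed[of "[a]" i] by (simp add: generates_via_def)
    then obtain v where v: "v \<in> lists (B i)" "cls i [a] = cls i (\<tau> v)"
      using \<pi> by auto
    have "cong_prod [a] (\<tau> v)"
      using factor[OF v(2) \<tau>_A[OF v(1)]] v(1) by (subst (asm) cls_eq) (cases i, auto intro!: \<tau>_lists)
    moreover have "cong_prod x (\<tau> u)"
      using u cls_eq[OF \<tau>_lists[OF u(1)]] by blast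
    ultimately have "cong_prod ([a] @ x) (\<tau> (v @ u))"
      unfolding \<tau>_append by (rule pres_cong.mult)
    moreover have "v @ u \<in> lists ?B" using u v by (cases i) auto
    ultimately show ?case using cls_eq[OF \<tau>_lists] by (metis append_Cons append_Nil)
  qed
  have gen_P: "generates_via P ?B ?\<rho>"
    unfolding generates_via_def
  proof (intro conjI)
    show "finite ?B" using gen by (simp add: generates_via_def)
    have car: "carrier P = ?cls ` lists ?A" by (simp add: presented_monoid_def)
    have closed: "?\<rho> u \<in> carrier P" if "u \<in> lists ?B" for u
      unfolding car using \<tau>_lists[OF that] by (rule imageI)
    have "?\<rho> (u @ v) = ?\<rho> u \<otimes>\<^bsub>P\<^esub> ?\<rho> v" if "u \<in> lists ?B" "v \<in> lists ?B" for u v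
      using presented_monoid_mult[OF that[THEN \<tau>_lists]] by (simp only: \<tau>_append)
    then show "?\<rho> \<in> hom (free_monoid ?B) P"
      using closed by (intro homI) (simp_all only: free_monoid_def monoid.simps partial_object.simps)
    show "?\<rho> [] = \<one>\<^bsub>P\<^esub>" by (simp add: \<tau>_def presented_monoid_def)
    show "?\<rho> ` lists ?B = carrier P"
    proof
      show "?\<rho> ` lists ?B \<subseteq> carrier P" using closed by blast
      show "carrier P \<subseteq> ?\<rho> ` lists ?B" unfolding car using surj by blast
    qed
  qed
  have compat: "?\<rho> u = ?\<rho> v" if "u \<in> lists (B i)" "v \<in> lists (B i)" "\<pi> i u = \<pi> i v" for i u v
    using that by (intro factor[of i] \<tau>_A) (simp_all only: \<pi>)
  have free: "map (\<lambda>(i, p). (i, \<pi> i p)) us = map (\<lambda>(i, p). (i, \<pi> i p)) vs"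
    if us: "reduced R (\<lambda>i p. \<pi> i p = \<one>\<^bsub>N i\<^esub>) us" and vs: "reduced R (\<lambda>i p. \<pi> i p = \<one>\<^bsub>N i\<^esub>) vs"
      and eq: "?\<rho> (flat us) = ?\<rho> (flat vs)" for us vs
  proof -
    have RB: "p \<in> lists (B i)" if "p \<in> R i" for p i
      using comb[of i] regular_language_lists that unfolding regular_combing_def by blast
    \<comment> \<open>Translating block by block preserves factors and values, hence reducedness, so
      \<open>reduced_unique\<close> applies to the images.\<close>
    let ?t = "map (\<lambda>(i, p). (i, \<tau> p))"
    have flat: "flat (?t ws) = \<tau> (flat ws)" for ws :: "(bool \<times> nat list) list"
      by (induction ws) (auto simp: \<tau>_append, simp add: \<tau>_def)
    have fst: "map fst (?t ws) = map fst ws" for ws :: "(bool \<times> nat list) list"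
      by (induction ws) auto
    have block: "\<tau> p \<in> lists (A i) \<and> \<pi> i p = cls i (\<tau> p) \<and> cls i (\<tau> p) \<noteq> \<one>\<^bsub>N i\<^esub>"
      if "reduced R (\<lambda>i p. \<pi> i p = \<one>\<^bsub>N i\<^esub>) ws" "(i, p) \<in> set ws" for ws i p
    proof -
      have "p \<in> R i" "\<pi> i p \<noteq> \<one>\<^bsub>N i\<^esub>" using that unfolding reduced_def by auto
      then show ?thesis using \<pi>[OF RB] \<tau>_A[OF RB] by metis
    qed
    have red: "reduced (\<lambda>i. lists (A i)) (\<lambda>i u. cls i u = \<one>\<^bsub>N i\<^esub>) (?t ws)"
      and val: "map (\<lambda>(i, u). (i, cls i u)) (?t ws) = map (\<lambda>(i, p). (i, \<pi> i p)) ws"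
      if ws: "reduced R (\<lambda>i p. \<pi> i p = \<one>\<^bsub>N i\<^esub>) ws" for ws
    proof -
      have "u \<in> lists (A i) \<and> cls i u \<noteq> \<one>\<^bsub>N i\<^esub>" if "(i, u) \<in> set (?t ws)" for i u
        using that block[OF ws] by auto
      then show "reduced (\<lambda>i. lists (A i)) (\<lambda>i u. cls i u = \<one>\<^bsub>N i\<^esub>) (?t ws)"
        using ws unfolding reduced_def fst by blast
      show "map (\<lambda>(i, u). (i, cls i u)) (?t ws) = map (\<lambda>(i, p). (i, \<pi> i p)) ws"
        using block[OF ws] by (simp add: case_prod_unfold)
    qed
    have "\<tau> (flat vs) \<in> lists ?A"
    proof -
      have "set p \<subseteq> ?B" if "(i, p) \<in> set vs" for i p
      proof -
        have "p \<in> R i" using vs that unfolding reduced_def by blast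
        from RB[OF this] show ?thesis by (cases i) auto
      qed
      then have "flat vs \<in> lists ?B" unfolding flat_def by fastforce
      then show ?thesis by (rule \<tau>_lists)
    qed
    with eq have "cong_prod (flat (?t us)) (flat (?t vs))"
      unfolding flat by (simp only: cls_eq)
    from reduced_unique[OF red[OF us] red[OF vs] this] show ?thesis
      unfolding val[OF us] val[OF vs] .
  qed
  have "free_factors N B \<pi> R P ?\<rho>"
    by (rule free_factors.intro[OF monoid_presented_monoid monoid_presented_monoid
          gen comb hyp R disj gen_P compat free])
  then show ?thesis by (rule free_factors_star_word_hyperbolic)
qed

end

theorem theorem4p4:
  fixes M1 :: "('m1, 'c1) monoid_scheme" and M2 :: "('m2, 'c2) monoid_scheme"
    and M :: "('m, 'c) monoid_scheme"
    and A1 A2 :: "'x set" and \<R>1 \<R>2 :: "('x list \<times> 'x list) set"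
  assumes "monoid M1" and "monoid M2" and "monoid M"
    and "is_presentation M1 A1 \<R>1" and "is_presentation M2 A2 \<R>2" and "A1 \<inter> A2 = {}"
    and "is_presentation M (A1 \<union> A2) (\<R>1 \<union> \<R>2)"
    and "star_word_hyperbolic M1" and "star_word_hyperbolic M2"
  shows "star_word_hyperbolic M"
proof -
  have factor: "star_word_hyperbolic (presented_monoid A1 \<R>1)"
    "star_word_hyperbolic (presented_monoid A2 \<R>2)"
    using assms(1,2,4,5,8,9) star_word_hyperbolic_iso[OF _ monoid_presented_monoid]
    unfolding is_presentation_def is_iso_def by blast+
  define A \<R> where "A i = (if i then A2 else A1)" and "\<R> i = (if i then \<R>2 else \<R>1)" for i
  interpret normal_forms A \<R>
    using assms(4,5,6) by unfold_locales (auto simp: A_def \<R>_def is_presentation_def)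
  have "star_word_hyperbolic (presented_monoid (A1 \<union> A2) (\<R>1 \<union> \<R>2))"
    using star_word_hyperbolic_free_product factor by (simp add: A_def \<R>_def)
  moreover obtain h where "h \<in> iso M (presented_monoid (A1 \<union> A2) (\<R>1 \<union> \<R>2))"
    using assms(7) unfolding is_presentation_def is_iso_def by blast
  ultimately show ?thesis
    using star_word_hyperbolic_iso[OF monoid_presented_monoid assms(3)] inverse_iso[OF assms(3)]
    by blast
qed

end
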